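(* Let $k$ be a commutative ring and $A$ a commutative $k$-algebra. The maps of graded $A$-algebras $$\vartheta^f:\Gamma_A\,\mathrm{IDer}^f_k(A)\to \mathrm{gr}\,\mathcal{D}_{A/k},\qquad \vartheta^\infty:\Gamma_A\,\mathrm{IDer}_k(A;\infty)\to \mathrm{gr}\,\mathcal{D}_{A/k}$$ are maps of Poisson algebras.
   Context: Integrable derivations. A Hasse--Schmidt derivation of $A$ over $k$ of length $m$ ($m$ a positive integer or $\infty$) is a family $D=(D_n)_{0\leq n\leq m}$ (all $n\in\mathbb{N}$ if $m=\infty$) of $k$-linear maps $A\to A$ with $D_0=\mathrm{Id}_A$ and $D_n(xy)=\sum_{i+j=n}D_i(x)D_j(y)$; they form the set $\mathrm{HS}_k(A;m)$. A $k$-derivation $\delta$ of $A$ is $m$-integrable if there is $D\in \mathrm{HS}_k(A;m)$ with $D_1=\delta$ (an $m$-integral of $\delta$). $\mathrm{IDer}_k(A;m)$ is the set of $m$-integrable $k$-derivations and $\mathrm{IDer}^f_k(A)=\bigcap_{m\geq1,\,m\in\mathbb{N}}\mathrm{IDer}_k(A;m)$. All these are $A$-submodules of $\mathrm{Der}_k(A)$ closed under the commutator bracket, hence Lie--Rinehart algebras over $A/k$ with anchor the inclusion in $\mathrm{Der}_k(A)$. (A Lie--Rinehart algebra $L$ over $A/k$ is a left $A$-module and $k$-Lie algebra with an anchor $L\to \mathrm{Der}_k(A)$, $A$-linear and a Lie algebra map, with $[\lambda,a\lambda']=a[\lambda,\lambda']+\lambda(a)\lambda'$.) Divided power algebra.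 For an $A$-module $M$, $\Gamma_AM=\bigoplus_{n\geq0}\Gamma^n_AM$ with maps $\gamma_n:M\to\Gamma^n_AM$ is the quotient of the polynomial algebra $A[\{x_{\lambda,n}\}_{\lambda\in M,n\geq0}]$ (with $\deg x_{\lambda,n}=n$) by the ideal generated by $x_{\lambda,0}-1$; $x_{a\lambda,m}-a^mx_{\lambda,m}$; $x_{\lambda,m}x_{\lambda,n}-\binom{m+n}{m}x_{\lambda,m+n}$; $x_{\lambda+\lambda',m}-\sum_{i+j=m}x_{\lambda,i}x_{\lambda',j}$; $\gamma_n(\lambda)$ is the class of $x_{\lambda,n}$. Poisson structures. A Poisson structure on a commutative $k$-algebra is a skew-symmetric $k$-biderivation satisfying the Jacobi identity; a map of Poisson algebras is a $k$-algebra map compatible with the brackets. If $L$ is a Lie--Rinehart algebra over $A/k$, $\Gamma_AL$ carries the unique Poisson structure such that $\{a,a'\}=0$, $\{\gamma_m(\lambda),a\}=\lambda(a)\gamma_{m-1}(\lambda)$ and $\{\gamma_m(\lambda),\gamma_n(\lambda')\}=\gamma_{m-1}(\lambda)\gamma_{n-1}(\lambda')\gamma_1([\lambda,\lambda'])$ for all $a,a'\in A$, $\lambda,\lambda'\in L$, $m,n\geq1$; this is the structure used on $\Gamma_A\mathrm{IDer}^f_k(A)$ and $\Gamma_A\mathrm{IDer}_k(A;\infty)$. Differential operators. $\mathcal{D}_{A/k}\subset\mathrm{End}_k(A)$ is the ring of ($k$-linear, Grothendieck) differential operators of $A$, filtered by order, $\mathcal{D}^d_{A/k}$ being the operators of order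 $\leq d$. Its graded ring $\mathrm{gr}\,\mathcal{D}_{A/k}$ is commutative; $\sigma_d:\mathcal{D}^d_{A/k}\to\mathrm{gr}^d\mathcal{D}_{A/k}$ is the symbol map. $\mathrm{gr}\,\mathcal{D}_{A/k}$ carries the Poisson bracket $\{\sigma_d(P),\sigma_e(Q)\}=\sigma_{d+e-1}([P,Q])$ for $P\in\mathcal{D}^d_{A/k}$, $Q\in\mathcal{D}^e_{A/k}$. The maps. $\vartheta^f$ is the unique map of graded $A$-algebras such that $\vartheta^f(\gamma_n(\delta))=\sigma_n(D_n)$ for all $\delta\in\mathrm{IDer}^f_k(A)$, $n\geq1$, where $D\in \mathrm{HS}_k(A;n)$ is any $n$-integral of $\delta$ (the symbol $\sigma_n(D_n)$ depends only on $\delta$). $\vartheta^\infty$ is the unique map of graded $A$-algebras such that $\vartheta^\infty(\gamma_n(\delta))=\sigma_n(D_n)$ for all $\delta\in\mathrm{IDer}_k(A;\infty)$ and $n\geq 1$, where $D\in \mathrm{HS}_k(A;\infty)$ is any $\infty$-integral of $\delta$; $\vartheta^f$ extends $\vartheta^\infty$. *)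

theory Defs
  imports "HOL-Algebra.QuotRing" "HOL-Library.Poly_Mapping" "HOL-Library.Extended_Nat"
begin

text \<open>
  Commutative rings with unit are types of sort \<open>{comm_ring, comm_monoid_mult}\<close>.  Unlike
  \<open>comm_ring_1\<close> this sort does not contain the axiom \<open>0 \<noteq> 1\<close>, so the zero ring is included.
  A commutative \<open>k\<close>-algebra is a unital ring homomorphism \<open>\<phi>\<close> from \<open>k\<close> to \<open>A\<close>, its structure map.
  The rings \<open>\<Gamma>\<^sub>A L\<close> and \<open>gr D\<close>, which have proper carriers, are ring records of HOL-Algebra.
\<close>

definition algebra_map ::
    "('k::{comm_ring,comm_monoid_mult} \<Rightarrow> 'a::{comm_ring,comm_monoid_mult}) \<Rightarrow> bool" where
  "algebra_map \<phi> \<longleftrightarrow>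
     (\<forall>c d. \<phi> (c + d) = \<phi> c + \<phi> d) \<and> (\<forall>c d. \<phi> (c * d) = \<phi> c * \<phi> d) \<and> \<phi> 1 = 1"

definition k_linear ::
    "('k::{comm_ring,comm_monoid_mult} \<Rightarrow> 'a::{comm_ring,comm_monoid_mult}) \<Rightarrow> ('a \<Rightarrow> 'a) \<Rightarrow> bool"
  where
  "k_linear \<phi> f \<longleftrightarrow>
     (\<forall>x y. f (x + y) = f x + f y) \<and> (\<forall>c x. f (\<phi> c * x) = \<phi> c * f x)"

definition commutator :: "('a::ab_group_add \<Rightarrow> 'a) \<Rightarrow> ('a \<Rightarrow> 'a) \<Rightarrow> 'a \<Rightarrow> 'a" where
  "commutator f g = (\<lambda>x. f (g x) - g (f x))"


section \<open>Integrable derivations\<close>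

definition Der ::
    "('k::{comm_ring,comm_monoid_mult} \<Rightarrow> 'a::{comm_ring,comm_monoid_mult}) \<Rightarrow> ('a \<Rightarrow> 'a) set" where
  "Der \<phi> = {\<delta>. k_linear \<phi> \<delta> \<and> (\<forall>x y. \<delta> (x * y) = \<delta> x * y + x * \<delta> y)}"

text \<open>
  A family \<open>(D\<^sub>n)\<close> with \<open>0 \<le> n \<le> m\<close> is represented by a sequence whose entries beyond \<open>m\<close> are
  unconstrained and never used.
\<close>

definition HS ::
    "('k::{comm_ring,comm_monoid_mult} \<Rightarrow> 'a::{comm_ring,comm_monoid_mult}) \<Rightarrow> enat \<Rightarrow>
     (nat \<Rightarrow> 'a \<Rightarrow> 'a) set" where
  "HS \<phi> m = {D. D 0 = id \<and>
     (\<forall>n. enat n \<le> m \<longrightarrow>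
        k_linear \<phi> (D n) \<and> (\<forall>x y. D n (x * y) = (\<Sum>i\<le>n. D i x * D (n - i) y)))}"

definition IDer ::
    "('k::{comm_ring,comm_monoid_mult} \<Rightarrow> 'a::{comm_ring,comm_monoid_mult}) \<Rightarrow> enat \<Rightarrow>
     ('a \<Rightarrow> 'a) set" where
  "IDer \<phi> m = {\<delta> \<in> Der \<phi>. \<exists>D \<in> HS \<phi> m. D 1 = \<delta>}"

definition IDer_f ::
    "('k::{comm_ring,comm_monoid_mult} \<Rightarrow> 'a::{comm_ring,comm_monoid_mult}) \<Rightarrow> ('a \<Rightarrow> 'a) set" where
  "IDer_f \<phi> = (\<Inter>m\<in>{1::nat..}. IDer \<phi> (enat m))"


section \<open>The divided power algebra of a module of derivations\<close>

text \<open>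
  \<open>L\<close> is an \<open>A\<close>-submodule of the maps \<open>A \<rightarrow> A\<close> with pointwise operations.  Polynomials live in a type
  with a variable for every pair of a map \<open>A \<rightarrow> A\<close> and a natural number; the carrier of
  \<open>dp_poly_ring L\<close> allows only the variables \<open>x\<^sub>\<lambda>\<^sub>,\<^sub>n\<close> with \<open>\<lambda> \<in> L\<close>.
\<close>

type_synonym 'a dp_monom = "(('a \<Rightarrow> 'a) \<times> nat) \<Rightarrow>\<^sub>0 nat"
type_synonym 'a dp_poly = "'a dp_monom \<Rightarrow>\<^sub>0 'a"

definition dp_poly_ring ::
    "('a::{comm_ring,comm_monoid_mult} \<Rightarrow> 'a) set \<Rightarrow> 'a dp_poly ring" where
  "dp_poly_ring L =
     \<lparr>carrier = {p. \<forall>t\<in>Poly_Mapping.keys p. Poly_Mapping.keys t \<subseteq> L \<times> UNIV},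
      monoid.mult = (*), one = Poly_Mapping.single 0 1, zero = 0, add = (+)\<rparr>"

definition dp_const :: "'a::{comm_ring,comm_monoid_mult} \<Rightarrow> 'a dp_poly" where
  "dp_const a = Poly_Mapping.single 0 a"

definition dp_var :: "('a::{comm_ring,comm_monoid_mult} \<Rightarrow> 'a) \<Rightarrow> nat \<Rightarrow> 'a dp_poly" where
  "dp_var l n = Poly_Mapping.single (Poly_Mapping.single (l, n) 1) 1"

text \<open>
  The integer multiple by a binomial coefficient is written as a repeated sum, because \<open>of_nat\<close>
  is not available without \<open>0 \<noteq> 1\<close>.
\<close>

definition dp_relations ::
    "('a::{comm_ring,comm_monoid_mult} \<Rightarrow> 'a) set \<Rightarrow> 'a dp_poly set" where
  "dp_relations L =
     {dp_var l 0 - dp_const 1 | l. l \<in> L} \<union>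
     {dp_var (\<lambda>x. a * l x) m - dp_const (a ^ m) * dp_var l m | a l m. l \<in> L} \<union>
     {dp_var l m * dp_var l n - (\<Sum>i<(m + n) choose m. dp_var l (m + n)) | l m n. l \<in> L} \<union>
     {dp_var (\<lambda>x. l x + l' x) m - (\<Sum>i\<le>m. dp_var l i * dp_var l' (m - i)) | l l' m.
        l \<in> L \<and> l' \<in> L}"

definition dp_ideal :: "('a::{comm_ring,comm_monoid_mult} \<Rightarrow> 'a) set \<Rightarrow> 'a dp_poly set" where
  "dp_ideal L = genideal (dp_poly_ring L) (dp_relations L)"

definition Gamma :: "('a::{comm_ring,comm_monoid_mult} \<Rightarrow> 'a) set \<Rightarrow> 'a dp_poly set ring" where
  "Gamma L = dp_poly_ring L Quot dp_ideal L"

definition Gamma_class ::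
    "('a::{comm_ring,comm_monoid_mult} \<Rightarrow> 'a) set \<Rightarrow> 'a dp_poly \<Rightarrow> 'a dp_poly set" where
  "Gamma_class L p = dp_ideal L +>\<^bsub>dp_poly_ring L\<^esub> p"

definition Gamma_const ::
    "('a::{comm_ring,comm_monoid_mult} \<Rightarrow> 'a) set \<Rightarrow> 'a \<Rightarrow> 'a dp_poly set" where
  "Gamma_const L a = Gamma_class L (dp_const a)"

definition dpow ::
    "('a::{comm_ring,comm_monoid_mult} \<Rightarrow> 'a) set \<Rightarrow> nat \<Rightarrow> ('a \<Rightarrow> 'a) \<Rightarrow> 'a dp_poly set" where
  "dpow L n l = Gamma_class L (dp_var l n)"

definition dp_weight :: "'a dp_monom \<Rightarrow> nat" where
  "dp_weight t = (\<Sum>v\<in>Poly_Mapping.keys t. Poly_Mapping.lookup t v * snd v)"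

definition Gamma_grade ::
    "('a::{comm_ring,comm_monoid_mult} \<Rightarrow> 'a) set \<Rightarrow> nat \<Rightarrow> 'a dp_poly set set" where
  "Gamma_grade L n =
     {Gamma_class L p | p. p \<in> carrier (dp_poly_ring L) \<and>
        (\<forall>t\<in>Poly_Mapping.keys p. dp_weight t = n)}"


section \<open>Poisson algebras\<close>

text \<open>A \<open>k\<close>-algebra is given here by a ring record \<open>R\<close> and a structure map \<open>\<kappa>\<close> into \<open>carrier R\<close>.\<close>

definition k_derivation_on :: "('r, 'm) ring_scheme \<Rightarrow> ('k \<Rightarrow> 'r) \<Rightarrow> ('r \<Rightarrow> 'r) \<Rightarrow> bool" where
  "k_derivation_on R \<kappa> d \<longleftrightarrow>
     d \<in> carrier R \<rightarrow> carrier R \<and>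
     (\<forall>x\<in>carrier R. \<forall>y\<in>carrier R. d (x \<oplus>\<^bsub>R\<^esub> y) = d x \<oplus>\<^bsub>R\<^esub> d y) \<and>
     (\<forall>c. \<forall>x\<in>carrier R. d (\<kappa> c \<otimes>\<^bsub>R\<^esub> x) = \<kappa> c \<otimes>\<^bsub>R\<^esub> d x) \<and>
     (\<forall>x\<in>carrier R. \<forall>y\<in>carrier R.
        d (x \<otimes>\<^bsub>R\<^esub> y) = (d x \<otimes>\<^bsub>R\<^esub> y) \<oplus>\<^bsub>R\<^esub> (x \<otimes>\<^bsub>R\<^esub> d y))"

definition poisson_structure ::
    "('r, 'm) ring_scheme \<Rightarrow> ('k \<Rightarrow> 'r) \<Rightarrow> ('r \<Rightarrow> 'r \<Rightarrow> 'r) \<Rightarrow> bool" where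
  "poisson_structure R \<kappa> B \<longleftrightarrow>
     (\<forall>x\<in>carrier R. k_derivation_on R \<kappa> (\<lambda>y. B x y)) \<and>
     (\<forall>y\<in>carrier R. k_derivation_on R \<kappa> (\<lambda>x. B x y)) \<and>
     (\<forall>x\<in>carrier R. \<forall>y\<in>carrier R. B x y = \<ominus>\<^bsub>R\<^esub> B y x) \<and>
     (\<forall>x\<in>carrier R. \<forall>y\<in>carrier R. \<forall>z\<in>carrier R.
        B x (B y z) \<oplus>\<^bsub>R\<^esub> B y (B z x) \<oplus>\<^bsub>R\<^esub> B z (B x y) = \<zero>\<^bsub>R\<^esub>)"

definition poisson_map ::
    "('r, 'm) ring_scheme \<Rightarrow> ('k \<Rightarrow> 'r) \<Rightarrow> ('r \<Rightarrow> 'r \<Rightarrow> 'r) \<Rightarrow>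
     ('s, 'n) ring_scheme \<Rightarrow> ('k \<Rightarrow> 's) \<Rightarrow> ('s \<Rightarrow> 's \<Rightarrow> 's) \<Rightarrow> ('r \<Rightarrow> 's) \<Rightarrow> bool" where
  "poisson_map R \<kappa>R BR S \<kappa>S BS h \<longleftrightarrow>
     h \<in> ring_hom R S \<and> (\<forall>c. h (\<kappa>R c) = \<kappa>S c) \<and>
     (\<forall>x\<in>carrier R. \<forall>y\<in>carrier R. h (BR x y) = BS (h x) (h y))"

text \<open>
  The Poisson bracket of \<open>\<Gamma>\<^sub>A L\<close>, where the Lie--Rinehart structure of \<open>L\<close> is given by the commutator
  and by the inclusion of \<open>L\<close> in the derivations as anchor.  It is characterised by its values on
  generators, so this predicate determines \<open>B\<close> on the carrier of \<open>Gamma L\<close>.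
\<close>

definition is_Gamma_bracket ::
    "('k::{comm_ring,comm_monoid_mult} \<Rightarrow> 'a::{comm_ring,comm_monoid_mult}) \<Rightarrow> ('a \<Rightarrow> 'a) set \<Rightarrow>
     ('a dp_poly set \<Rightarrow> 'a dp_poly set \<Rightarrow> 'a dp_poly set) \<Rightarrow> bool" where
  "is_Gamma_bracket \<phi> L B \<longleftrightarrow>
     poisson_structure (Gamma L) (\<lambda>c. Gamma_const L (\<phi> c)) B \<and>
     (\<forall>a a'. B (Gamma_const L a) (Gamma_const L a') = \<zero>\<^bsub>Gamma L\<^esub>) \<and>
     (\<forall>a. \<forall>l\<in>L. \<forall>m\<ge>1.
        B (dpow L m l) (Gamma_const L a) = Gamma_const L (l a) \<otimes>\<^bsub>Gamma L\<^esub> dpow L (m - 1) l) \<and>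
     (\<forall>l\<in>L. \<forall>l'\<in>L. \<forall>m\<ge>1. \<forall>n\<ge>1.
        B (dpow L m l) (dpow L n l') =
          dpow L (m - 1) l \<otimes>\<^bsub>Gamma L\<^esub> dpow L (n - 1) l' \<otimes>\<^bsub>Gamma L\<^esub> dpow L 1 (commutator l l'))"


section \<open>Differential operators and their graded ring\<close>

text \<open>
  \<open>diffop_lt \<phi> d\<close> is the set of differential operators of order strictly less than \<open>d\<close>, that is,
  of order at most \<open>d - 1\<close>, where operators of order at most \<open>-1\<close> are zero.
\<close>

primrec diffop_lt ::
    "('k::{comm_ring,comm_monoid_mult} \<Rightarrow> 'a::{comm_ring,comm_monoid_mult}) \<Rightarrow> nat \<Rightarrow>
     ('a \<Rightarrow> 'a) set" where
  "diffop_lt \<phi> 0 = {\<lambda>x. 0}"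
| "diffop_lt \<phi> (Suc d) =
     {P. k_linear \<phi> P \<and> (\<forall>a. commutator P (\<lambda>x. a * x) \<in> diffop_lt \<phi> d)}"

definition diffop ::
    "('k::{comm_ring,comm_monoid_mult} \<Rightarrow> 'a::{comm_ring,comm_monoid_mult}) \<Rightarrow> nat \<Rightarrow>
     ('a \<Rightarrow> 'a) set" where
  "diffop \<phi> d = diffop_lt \<phi> (Suc d)"

text \<open>
  An element of \<open>gr D\<close> is a finitely supported family \<open>F\<close> whose member \<open>F d\<close> is a coset of
  \<open>diffop_lt \<phi> d\<close> in \<open>diffop \<phi> d\<close>.  As for \<open>Quot\<close>, operations on cosets are unions over all
  representatives; the united cosets coincide.
\<close>

definition gr_coset ::
    "('k::{comm_ring,comm_monoid_mult} \<Rightarrow> 'a::{comm_ring,comm_monoid_mult}) \<Rightarrow> nat \<Rightarrow>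
     ('a \<Rightarrow> 'a) \<Rightarrow> ('a \<Rightarrow> 'a) set" where
  "gr_coset \<phi> d P = {\<lambda>x. P x + R x | R. R \<in> diffop_lt \<phi> d}"

definition symb ::
    "('k::{comm_ring,comm_monoid_mult} \<Rightarrow> 'a::{comm_ring,comm_monoid_mult}) \<Rightarrow> nat \<Rightarrow>
     ('a \<Rightarrow> 'a) \<Rightarrow> nat \<Rightarrow> ('a \<Rightarrow> 'a) set" where
  "symb \<phi> d P = (\<lambda>n. gr_coset \<phi> n (if n = d then P else (\<lambda>x. 0)))"

definition gr_ring ::
    "('k::{comm_ring,comm_monoid_mult} \<Rightarrow> 'a::{comm_ring,comm_monoid_mult}) \<Rightarrow>
     (nat \<Rightarrow> ('a \<Rightarrow> 'a) set) ring" where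
  "gr_ring \<phi> =
     \<lparr>carrier = {F. (\<forall>d. F d \<in> gr_coset \<phi> d ` diffop \<phi> d) \<and> finite {d. F d \<noteq> diffop_lt \<phi> d}},
      monoid.mult = (\<lambda>F G n. \<Union>P\<in>Pi UNIV F. \<Union>Q\<in>Pi UNIV G.
        gr_coset \<phi> n (\<lambda>x. \<Sum>i\<le>n. P i (Q (n - i) x))),
      one = symb \<phi> 0 id,
      zero = (\<lambda>d. diffop_lt \<phi> d),
      add = (\<lambda>F G n. \<Union>P\<in>F n. \<Union>Q\<in>G n. gr_coset \<phi> n (\<lambda>x. P x + Q x))\<rparr>"

definition gr_const ::
    "('k::{comm_ring,comm_monoid_mult} \<Rightarrow> 'a::{comm_ring,comm_monoid_mult}) \<Rightarrow> 'a \<Rightarrow>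
     nat \<Rightarrow> ('a \<Rightarrow> 'a) set" where
  "gr_const \<phi> a = symb \<phi> 0 (\<lambda>x. a * x)"

definition gr_grade ::
    "('k::{comm_ring,comm_monoid_mult} \<Rightarrow> 'a::{comm_ring,comm_monoid_mult}) \<Rightarrow> nat \<Rightarrow>
     (nat \<Rightarrow> ('a \<Rightarrow> 'a) set) set" where
  "gr_grade \<phi> d = symb \<phi> d ` diffop \<phi> d"

text \<open>
  The biadditive extension of \<open>{\<sigma>\<^sub>d(P), \<sigma>\<^sub>e(Q)} = \<sigma>\<^sub>d\<^sub>+\<^sub>e\<^sub>-\<^sub>1([P, Q])\<close>: the component of degree \<open>n\<close>
  collects the pairs with \<open>d + e = n + 1\<close>, and the pair \<open>d = e = 0\<close> contributes nothing.
\<close>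

definition gr_bracket ::
    "('k::{comm_ring,comm_monoid_mult} \<Rightarrow> 'a::{comm_ring,comm_monoid_mult}) \<Rightarrow>
     (nat \<Rightarrow> ('a \<Rightarrow> 'a) set) \<Rightarrow> (nat \<Rightarrow> ('a \<Rightarrow> 'a) set) \<Rightarrow> nat \<Rightarrow> ('a \<Rightarrow> 'a) set" where
  "gr_bracket \<phi> F G = (\<lambda>n. \<Union>P\<in>Pi UNIV F. \<Union>Q\<in>Pi UNIV G.
     gr_coset \<phi> n (\<lambda>x. \<Sum>i\<le>Suc n. commutator (P i) (Q (Suc n - i)) x))"


section \<open>The maps into the graded ring\<close>

definition graded_algebra_map ::
    "('k::{comm_ring,comm_monoid_mult} \<Rightarrow> 'a::{comm_ring,comm_monoid_mult}) \<Rightarrow> ('a \<Rightarrow> 'a) set \<Rightarrow>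
     ('a dp_poly set \<Rightarrow> nat \<Rightarrow> ('a \<Rightarrow> 'a) set) \<Rightarrow> bool" where
  "graded_algebra_map \<phi> L \<theta> \<longleftrightarrow>
     \<theta> \<in> ring_hom (Gamma L) (gr_ring \<phi>) \<and>
     (\<forall>a. \<theta> (Gamma_const L a) = gr_const \<phi> a) \<and>
     (\<forall>n. \<theta> ` Gamma_grade L n \<subseteq> gr_grade \<phi> n)"

text \<open>
  The maps \<open>\<vartheta>\<^sup>f\<close> and \<open>\<vartheta>\<^sup>\<infinity>\<close> are specified by the properties that determine them on the carrier of
  the divided power algebra.
\<close>

definition is_vartheta_f ::
    "('k::{comm_ring,comm_monoid_mult} \<Rightarrow> 'a::{comm_ring,comm_monoid_mult}) \<Rightarrow>
     ('a dp_poly set \<Rightarrow> nat \<Rightarrow> ('a \<Rightarrow> 'a) set) \<Rightarrow> bool" where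
  "is_vartheta_f \<phi> \<theta> \<longleftrightarrow>
     graded_algebra_map \<phi> (IDer_f \<phi>) \<theta> \<and>
     (\<forall>\<delta>\<in>IDer_f \<phi>. \<forall>n\<ge>1. \<forall>D\<in>HS \<phi> (enat n). D 1 = \<delta> \<longrightarrow>
        \<theta> (dpow (IDer_f \<phi>) n \<delta>) = symb \<phi> n (D n))"

definition is_vartheta_inf ::
    "('k::{comm_ring,comm_monoid_mult} \<Rightarrow> 'a::{comm_ring,comm_monoid_mult}) \<Rightarrow>
     ('a dp_poly set \<Rightarrow> nat \<Rightarrow> ('a \<Rightarrow> 'a) set) \<Rightarrow> bool" where
  "is_vartheta_inf \<phi> \<theta> \<longleftrightarrow>
     graded_algebra_map \<phi> (IDer \<phi> \<infinity>) \<theta> \<and>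
     (\<forall>\<delta>\<in>IDer \<phi> \<infinity>. \<forall>n\<ge>1. \<forall>D\<in>HS \<phi> \<infinity>. D 1 = \<delta> \<longrightarrow>
        \<theta> (dpow (IDer \<phi> \<infinity>) n \<delta>) = symb \<phi> n (D n))"

end

theory Submission
  imports Defs
begin

text \<open>
  Both \<open>\<theta> {x, y}\<close> and \<open>{\<theta> x, \<theta> y}\<close> are skew biderivations along \<open>\<theta>\<close>, so they need to be compared only
  on constants and divided powers.  There the claim is about symbols of commutators of integrals
  \<open>D\<close> of \<open>\<delta>\<close> and \<open>E\<close> of \<open>\<epsilon>\<close>: modulo lower order, \<open>[D\<^sub>m, a] = \<delta>(a) D\<^sub>m\<^sub>-\<^sub>1\<close> and
  \<open>[D\<^sub>m, E\<^sub>n] = D\<^sub>m\<^sub>-\<^sub>1 E\<^sub>n\<^sub>-\<^sub>1 [\<delta>, \<epsilon>]\<close>.  The second congruence follows by induction on \<open>m + n\<close>, because the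
  order of an operator drops under all commutators with multiplications \<open>a\<close>, and the commutators of
  both sides with \<open>a\<close> are computed by the Jacobi identity, the first congruence and the induction
  hypothesis.
\<close>

section \<open>Orders of differential operators\<close>

declare diffop_lt.simps(2) [simp del]

lemma k_linear_additive: "k_linear \<phi> f \<Longrightarrow> additive f"
  by (auto simp: k_linear_def additive_def)

lemma diffop_lt_k_linear: "P \<in> diffop_lt \<phi> d \<Longrightarrow> k_linear \<phi> P"
  by (cases d) (auto simp: k_linear_def diffop_lt.simps(2))

lemma diffop_lt_additive: "P \<in> diffop_lt \<phi> d \<Longrightarrow> additive P"
  by (rule k_linear_additive[OF diffop_lt_k_linear])

lemma diffop_lt_SucI:
  "\<lbrakk>k_linear \<phi> P; \<And>a. commutator P (\<lambda>x. a * x) \<in> diffop_lt \<phi> d\<rbrakk> \<Longrightarrow> P \<in> diffop_lt \<phi> (Suc d)"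
  by (simp add: diffop_lt.simps(2))

text \<open>The truncated \<open>d - 1\<close> covers \<open>d = 0\<close> as well: there
  \<open>P\<close> is zero and so are its commutators.\<close>

lemma diffop_lt_commutator_mult:
  "P \<in> diffop_lt \<phi> d \<Longrightarrow> commutator P (\<lambda>x. a * x) \<in> diffop_lt \<phi> (d - 1)"
  by (cases d) (auto simp: diffop_lt.simps(2) commutator_def)

lemma k_linear_zero: "k_linear \<phi> (\<lambda>x. 0)"
  by (simp add: k_linear_def)

lemma k_linear_mult: "k_linear \<phi> (\<lambda>x. a * x)"
  by (simp add: k_linear_def algebra_simps)

lemma k_linear_add: "\<lbrakk>k_linear \<phi> P; k_linear \<phi> Q\<rbrakk> \<Longrightarrow> k_linear \<phi> (\<lambda>x. P x + Q x)"
  by (simp add: k_linear_def algebra_simps)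

lemma k_linear_uminus: "k_linear \<phi> P \<Longrightarrow> k_linear \<phi> (\<lambda>x. - P x)"
  by (simp add: k_linear_def algebra_simps)

lemma k_linear_diff: "\<lbrakk>k_linear \<phi> P; k_linear \<phi> Q\<rbrakk> \<Longrightarrow> k_linear \<phi> (\<lambda>x. P x - Q x)"
  by (simp add: k_linear_def algebra_simps)

lemma k_linear_compose: "\<lbrakk>k_linear \<phi> P; k_linear \<phi> Q\<rbrakk> \<Longrightarrow> k_linear \<phi> (\<lambda>x. P (Q x))"
  by (simp add: k_linear_def)

lemma k_linear_commutator: "\<lbrakk>k_linear \<phi> P; k_linear \<phi> Q\<rbrakk> \<Longrightarrow> k_linear \<phi> (commutator P Q)"
  unfolding commutator_def by (intro k_linear_diff k_linear_compose[of \<phi> P Q] k_linear_compose[of \<phi> Q P])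

lemma diffop_lt_zero [simp]: "(\<lambda>x. 0) \<in> diffop_lt \<phi> d"
  by (induction d) (simp_all add: diffop_lt.simps(2) k_linear_zero commutator_def)

lemma diffop_lt_add:
  "\<lbrakk>P \<in> diffop_lt \<phi> d; Q \<in> diffop_lt \<phi> d\<rbrakk> \<Longrightarrow> (\<lambda>x. P x + Q x) \<in> diffop_lt \<phi> d"
proof (induction d arbitrary: P Q)
  case (Suc d)
  have "commutator (\<lambda>x. P x + Q x) (\<lambda>x. a * x) =
      (\<lambda>x. commutator P (\<lambda>x. a * x) x + commutator Q (\<lambda>x. a * x) x)" for a
    by (simp add: commutator_def algebra_simps)
  with Suc show ?case
    by (simp add: k_linear_add diffop_lt.simps(2))
qed simp

lemma diffop_lt_uminus: "P \<in> diffop_lt \<phi> d \<Longrightarrow> (\<lambda>x. - P x) \<in> diffop_lt \<phi> d"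
proof (induction d arbitrary: P)
  case (Suc d)
  have "commutator (\<lambda>x. - P x) (\<lambda>x. a * x) = (\<lambda>x. - commutator P (\<lambda>x. a * x) x)" for a
    by (simp add: commutator_def algebra_simps)
  with Suc show ?case
    by (simp add: k_linear_uminus diffop_lt.simps(2))
qed simp

lemma diffop_lt_diff:
  "\<lbrakk>P \<in> diffop_lt \<phi> d; Q \<in> diffop_lt \<phi> d\<rbrakk> \<Longrightarrow> (\<lambda>x. P x - Q x) \<in> diffop_lt \<phi> d"
  using diffop_lt_add[OF _ diffop_lt_uminus, of P \<phi> d Q] by simp

lemma diffop_lt_sum:
  "(\<And>i. i \<in> I \<Longrightarrow> P i \<in> diffop_lt \<phi> d) \<Longrightarrow> (\<lambda>x. \<Sum>i\<in>I. P i x) \<in> diffop_lt \<phi> d"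
  by (induction I rule: infinite_finite_induct) (simp_all add: diffop_lt_add)

lemma diffop_lt_Suc: "diffop_lt \<phi> d \<subseteq> diffop_lt \<phi> (Suc d)"
proof (induction d)
  case (Suc d)
  show ?case
  proof
    fix P assume "P \<in> diffop_lt \<phi> (Suc d)"
    with Suc show "P \<in> diffop_lt \<phi> (Suc (Suc d))"
      unfolding diffop_lt.simps(2)[of \<phi> d] diffop_lt.simps(2)[of \<phi> "Suc d"] by blast
  qed
qed (auto simp: diffop_lt.simps(2) k_linear_zero commutator_def)

lemma diffop_lt_mono: "d \<le> e \<Longrightarrow> diffop_lt \<phi> d \<subseteq> diffop_lt \<phi> e"
  by (rule lift_Suc_mono_le[of "diffop_lt \<phi>", OF diffop_lt_Suc])

lemma diffop_ltD: "\<lbrakk>P \<in> diffop_lt \<phi> d; d \<le> e\<rbrakk> \<Longrightarrow> P \<in> diffop_lt \<phi> e"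
  using diffop_lt_mono[of d e \<phi>] by (rule subsetD)

lemma diffop_lt_mult: "(\<lambda>x. a * x) \<in> diffop_lt \<phi> (Suc d)"
proof (rule diffop_ltD)
  show "(\<lambda>x. a * x) \<in> diffop_lt \<phi> (Suc 0)"
    by (simp add: diffop_lt.simps k_linear_mult commutator_def mult.left_commute)
qed simp

text \<open>Commuting \<open>P\<close> with multiplication by \<open>x\<close> and evaluating at
  \<open>1\<close> gives the formula.\<close>

lemma diffop_lt_1_eq_mult: "P \<in> diffop_lt \<phi> (Suc 0) \<Longrightarrow> P = (\<lambda>x. P 1 * x)"
proof
  fix x
  assume "P \<in> diffop_lt \<phi> (Suc 0)"
  then have "commutator P (\<lambda>y. x * y) = (\<lambda>y. 0)"
    by (auto simp: diffop_lt.simps)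
  then have "P (x * 1) - x * P 1 = 0"
    unfolding commutator_def by metis
  then show "P x = P 1 * x"
    by (simp add: mult.commute)
qed

text \<open>The bounds are strict: orders d-1 and e-1 add up to d+e-2, which lies below
  \<open>d + e - 1\<close>. The induction runs through [PQ, a] = P [Q, a] + [P, a] Q; a bound
  \<open>0\<close> makes the composite zero.\<close>

lemma diffop_lt_compose:
  fixes \<phi> :: "'k::{comm_ring,comm_monoid_mult} \<Rightarrow> 'a::{comm_ring,comm_monoid_mult}"
  shows "\<lbrakk>P \<in> diffop_lt \<phi> d; Q \<in> diffop_lt \<phi> e\<rbrakk> \<Longrightarrow> (\<lambda>x. P (Q x)) \<in> diffop_lt \<phi> (d + e - 1)"
proof (induction "d + e" arbitrary: d e P Q)
  case (Suc s)
  note PQ = Suc.prems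
  interpret P: additive P using PQ diffop_lt_additive by blast
  interpret Q: additive Q using PQ diffop_lt_additive by blast
  show ?case
  proof (cases "d = 0 \<or> e = 0")
    case True
    with PQ have "(\<lambda>x. P (Q x)) = (\<lambda>x. 0)"
      using P.zero by auto
    then show ?thesis by (simp only: diffop_lt_zero)
  next
    case False
    then obtain d' e' where de: "d = Suc d'" "e = Suc e'"
      by (meson not0_implies_Suc)
    have comm: "commutator P (\<lambda>x. a * x) \<in> diffop_lt \<phi> d'" "commutator Q (\<lambda>x. a * x) \<in> diffop_lt \<phi> e'" for a
      using diffop_lt_commutator_mult[OF PQ(1)] diffop_lt_commutator_mult[OF PQ(2)] de by simp_all
    have "(\<lambda>x. P (Q x)) \<in> diffop_lt \<phi> (Suc (d' + e'))"
    proof (rule diffop_lt_SucI)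
      show "k_linear \<phi> (\<lambda>x. P (Q x))"
        by (rule k_linear_compose[OF PQ[THEN diffop_lt_k_linear]])
      fix a :: 'a
      let ?a = "\<lambda>x. a * x"
      have "commutator (\<lambda>x. P (Q x)) ?a = (\<lambda>x. P (commutator Q ?a x) + commutator P ?a (Q x))"
        by (simp add: commutator_def P.diff)
      also have "\<dots> \<in> diffop_lt \<phi> (d' + e')"
        using Suc.hyps(1)[of d e' P "commutator Q ?a"] Suc.hyps(1)[of d' e "commutator P ?a" Q]
          Suc.hyps(2) PQ comm
        by (intro diffop_lt_add) (auto simp: de)
      finally show "commutator (\<lambda>x. P (Q x)) ?a \<in> diffop_lt \<phi> (d' + e')" .
    qed
    then show ?thesis by (simp add: de)
  qed
qed (use additive.zero[OF diffop_lt_additive] in auto)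

lemma diffop_lt_compose':
  "\<lbrakk>P \<in> diffop_lt \<phi> d; Q \<in> diffop_lt \<phi> e; d + e \<le> Suc f\<rbrakk> \<Longrightarrow> (\<lambda>x. P (Q x)) \<in> diffop_lt \<phi> f"
  by (rule diffop_ltD[OF diffop_lt_compose[of P \<phi> d Q e]]) simp_all

lemma diffop_lt_scale: "P \<in> diffop_lt \<phi> d \<Longrightarrow> (\<lambda>x. a * P x) \<in> diffop_lt \<phi> d"
  by (rule diffop_lt_compose'[OF diffop_lt_mult[of a _ 0]]) auto

text \<open>The commutator loses one more order than the composite. The Jacobi rule [[P, Q], a] =
  [[P, a], Q] + [P, [Q, a]] carries the induction, which ends at two multiplications; these
  commute.\<close>

lemma diffop_lt_commutator:
  fixes \<phi> :: "'k::{comm_ring,comm_monoid_mult} \<Rightarrow> 'a::{comm_ring,comm_monoid_mult}"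
  shows "\<lbrakk>P \<in> diffop_lt \<phi> d; Q \<in> diffop_lt \<phi> e\<rbrakk> \<Longrightarrow> commutator P Q \<in> diffop_lt \<phi> (d + e - 2)"
proof (induction "d + e" arbitrary: d e P Q rule: less_induct)
  case less
  note PQ = less.prems
  interpret P: additive P using PQ diffop_lt_additive by blast
  interpret Q: additive Q using PQ diffop_lt_additive by blast
  \<comment> \<open>In the third case \<open>d + e - 2\<close> equals \<open>Suc f\<close>, so
    neither the goal nor the two induction hypotheses suffer from truncated subtraction.\<close>
  consider "d = 0 \<or> e = 0" | "d = 1" "e = 1" | d' e' f where "d = Suc d'" "e = Suc e'" "d' + e' = Suc f"
    by (cases d; cases e; cases "d - 1 + (e - 1)") auto
  then show ?case
  proof cases
    case 1
    with PQ have "commutator P Q = (\<lambda>x. 0)"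
      using P.zero Q.zero by (auto simp: commutator_def)
    then show ?thesis by (simp only: diffop_lt_zero)
  next
    case 2
    then have "P = (\<lambda>x. P 1 * x)" "Q = (\<lambda>x. Q 1 * x)"
      using PQ diffop_lt_1_eq_mult by auto
    then have "commutator P Q = commutator (\<lambda>x. P 1 * x) (\<lambda>x. Q 1 * x)" by simp
    then show ?thesis using 2 by (simp add: commutator_def mult.left_commute)
  next
    case 3
    have comm: "commutator P (\<lambda>x. a * x) \<in> diffop_lt \<phi> d'" "commutator Q (\<lambda>x. a * x) \<in> diffop_lt \<phi> e'" for a
      using diffop_lt_commutator_mult[OF PQ(1)] diffop_lt_commutator_mult[OF PQ(2)] 3 by simp_all
    have "commutator P Q \<in> diffop_lt \<phi> (Suc f)"
    proof (rule diffop_lt_SucI)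
      show "k_linear \<phi> (commutator P Q)"
        by (rule k_linear_commutator[OF PQ[THEN diffop_lt_k_linear]])
      fix a :: 'a
      let ?a = "\<lambda>x. a * x"
      have "commutator (commutator P Q) ?a =
          (\<lambda>x. commutator (commutator P ?a) Q x + commutator P (commutator Q ?a) x)"
        by (simp add: commutator_def P.diff Q.diff algebra_simps)
      also have "\<dots> \<in> diffop_lt \<phi> f"
        using less.hyps[of d' e "commutator P ?a" Q] less.hyps[of d e' P "commutator Q ?a"] PQ comm 3
        by (intro diffop_lt_add) auto
      finally show "commutator (commutator P Q) ?a \<in> diffop_lt \<phi> f" .
    qed
    then show ?thesis using 3 by simp
  qed
qed

lemma diffop_lt_commutator':
  "\<lbrakk>P \<in> diffop_lt \<phi> d; Q \<in> diffop_lt \<phi> e; d + e \<le> f + 2\<rbrakk> \<Longrightarrow> commutator P Q \<in> diffop_lt \<phi> f"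
  by (erule (1) diffop_ltD[OF diffop_lt_commutator]) linarith

text \<open>For \<open>d = 0\<close> the subtraction truncates and the general bound for composites
  would be one too large, but then \<open>P\<close> is zero.\<close>

lemma diffop_lt_compose_pred:
  "\<lbrakk>P \<in> diffop_lt \<phi> (d - 1); Q \<in> diffop_lt \<phi> (Suc (Suc e))\<rbrakk> \<Longrightarrow> (\<lambda>x. P (Q x)) \<in> diffop_lt \<phi> (d + e)"
  using diffop_lt_compose'[of P \<phi> "d - 1" Q "Suc (Suc e)" "d + e"] by (cases d) auto

section \<open>Commutators of Hasse--Schmidt derivations\<close>

lemma HS_mono: "\<lbrakk>D \<in> HS \<phi> m; n \<le> m\<rbrakk> \<Longrightarrow> D \<in> HS \<phi> n"
  by (auto simp: HS_def)

lemma HS_0: "D \<in> HS \<phi> m \<Longrightarrow> D 0 = id"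
  by (simp add: HS_def)

lemma HS_k_linear: "\<lbrakk>D \<in> HS \<phi> (enat m); i \<le> m\<rbrakk> \<Longrightarrow> k_linear \<phi> (D i)"
  by (simp add: HS_def)

lemma HS_Leibniz:
  "\<lbrakk>D \<in> HS \<phi> (enat m); i \<le> m\<rbrakk> \<Longrightarrow> D i (x * y) = (\<Sum>j\<le>i. D j x * D (i - j) y)"
  by (simp add: HS_def)

lemma HS_1_Leibniz:
  assumes "D \<in> HS \<phi> (enat m)" "1 \<le> m"
  shows "D 1 (x * y) = D 1 x * y + x * D 1 y"
  using HS_Leibniz[OF assms, of x y] HS_0[OF assms(1)] by (simp add: add.commute)

text \<open>The \<open>j = 0\<close> term of the Leibniz sum is \<open>a * D i x\<close>, because
  \<open>D 0 = id\<close>; the commutator removes exactly this term.\<close>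

lemma HS_commutator_mult:
  assumes "D \<in> HS \<phi> (enat m)" "i \<le> m"
  shows "commutator (D i) (\<lambda>x. a * x) = (\<lambda>x. \<Sum>j<i. D (Suc j) a * D (i - Suc j) x)"
proof
  fix x
  have "D i (a * x) = a * D i x + (\<Sum>j<i. D (Suc j) a * D (i - Suc j) x)"
    unfolding HS_Leibniz[OF assms] by (subst sum.atMost_shift) (simp add: HS_0[OF assms(1)])
  then show "commutator (D i) (\<lambda>x. a * x) x = (\<Sum>j<i. D (Suc j) a * D (i - Suc j) x)"
    by (simp add: commutator_def)
qed

text \<open>Commutators with multiplications are combinations of members of smaller index, so strong
  induction on the index bounds the order.\<close>

lemma HS_diffop: "\<lbrakk>D \<in> HS \<phi> (enat m); i \<le> m\<rbrakk> \<Longrightarrow> D i \<in> diffop_lt \<phi> (Suc i)"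
proof (induction i rule: less_induct)
  case (less i)
  show ?case
  proof (rule diffop_lt_SucI)
    fix a
    show "commutator (D i) (\<lambda>x. a * x) \<in> diffop_lt \<phi> i"
      unfolding HS_commutator_mult[OF less.prems]
    proof (intro diffop_lt_sum diffop_lt_scale)
      fix j assume "j \<in> {..<i}"
      then have "i - Suc j < i" "i - Suc j \<le> m"
        using less.prems by auto
      from less.IH[OF this(1) less.prems(1) this(2)] show "D (i - Suc j) \<in> diffop_lt \<phi> i"
        by (rule diffop_ltD) (use \<open>i - Suc j < i\<close> in simp)
    qed
  qed (rule HS_k_linear[OF less.prems])
qed

text \<open>Setting \<open>D\<^sub>-\<^sub>1 = 0\<close> makes the commutator formulas below hold in all degrees.\<close>

definition HS_pred :: "(nat \<Rightarrow> 'a \<Rightarrow> 'a::zero) \<Rightarrow> nat \<Rightarrow> 'a \<Rightarrow> 'a" where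
  "HS_pred D i = (case i of 0 \<Rightarrow> \<lambda>x. 0 | Suc j \<Rightarrow> D j)"

lemma HS_pred_simps [simp]: "HS_pred D 0 = (\<lambda>x. 0)" "HS_pred D (Suc i) = D i"
  by (simp_all add: HS_pred_def)

lemma HS_pred_diffop: "\<lbrakk>D \<in> HS \<phi> (enat m); i \<le> m\<rbrakk> \<Longrightarrow> HS_pred D i \<in> diffop_lt \<phi> i"
  using HS_diffop[of D \<phi> m "i - 1"] by (cases i) auto

text \<open>The first term of the sum for the commutator is \<open>D 1 a * D (i - 1) x\<close>; the
  others contain members of index at most i-2, hence of order at most i-2. For \<open>i = 0\<close>
  everything vanishes.\<close>

lemma HS_commutator_mult_cong:
  assumes "D \<in> HS \<phi> (enat m)" "i \<le> m"
  shows "(\<lambda>x. commutator (D i) (\<lambda>x. a * x) x - D 1 a * HS_pred D i x) \<in> diffop_lt \<phi> (i - 1)"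
proof (cases i)
  case 0
  then show ?thesis using HS_0[OF assms(1)] by (simp add: commutator_def)
next
  case (Suc j)
  have "commutator (D i) (\<lambda>x. a * x) x - D 1 a * HS_pred D i x =
      (\<Sum>l<j. D (Suc (Suc l)) a * D (j - Suc l) x)" for x
    unfolding HS_commutator_mult[OF assms] by (simp add: Suc sum.lessThan_Suc_shift del: sum.lessThan_Suc)
  moreover have "(\<lambda>x. \<Sum>l<j. D (Suc (Suc l)) a * D (j - Suc l) x) \<in> diffop_lt \<phi> j"
  proof (intro diffop_lt_sum diffop_lt_scale)
    fix l assume "l \<in> {..<j}"
    then show "D (j - Suc l) \<in> diffop_lt \<phi> j"
      using assms Suc by (intro diffop_ltD[OF HS_diffop[OF assms(1), of "j - Suc l"]]) auto
  qed
  ultimately show ?thesis by (simp add: Suc)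
qed

text \<open>The indices \<open>i\<close> and \<open>j\<close> vary below fixed lengths so that the
  induction can lower them while \<open>D\<close>, \<open>E\<close> and the derivations
  \<open>D 1\<close>, \<open>E 1\<close> stay the same. For positive indices the composite has order
  at most i+j-1, and the difference has smaller order, so the symbols in that degree agree.\<close>

lemma HS_commutator_cong:
  fixes \<phi> :: "'k::{comm_ring,comm_monoid_mult} \<Rightarrow> 'a::{comm_ring,comm_monoid_mult}"
  assumes D: "D \<in> HS \<phi> (enat m)" "i \<le> m" and E: "E \<in> HS \<phi> (enat n)" "j \<le> n" and "1 \<le> m" "1 \<le> n"
  shows "(\<lambda>x. commutator (D i) (E j) x - HS_pred D i (HS_pred E j (commutator (D 1) (E 1) x)))
    \<in> diffop_lt \<phi> (i + j - 1)"
  using D(2) E(2)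
proof (induction "i + j" arbitrary: i j rule: less_induct)
  case less
  define \<kappa> where "\<kappa> = commutator (D 1) (E 1)"
  have dD: "D l \<in> diffop_lt \<phi> (Suc l)" "HS_pred D l \<in> diffop_lt \<phi> l" if "l \<le> m" for l
    using HS_diffop[OF D(1) that] HS_pred_diffop[OF D(1) that] by auto
  have dE: "E l \<in> diffop_lt \<phi> (Suc l)" "HS_pred E l \<in> diffop_lt \<phi> l" if "l \<le> n" for l
    using HS_diffop[OF E(1) that] HS_pred_diffop[OF E(1) that] by auto
  have k2: "\<kappa> \<in> diffop_lt \<phi> 2"
    unfolding \<kappa>_def using dD(1)[of 1] dE(1)[of 1] assms
    by (intro diffop_lt_commutator'[where d = 2 and e = 2]) (simp_all add: numeral_2_eq_2)
  \<comment> \<open>The commutator of two derivations is a derivation; this splits \<kappa>(a x)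
    when the composite is commuted with \<open>a\<close>.\<close>
  have \<kappa>_Leibniz: "\<kappa> (x * y) = \<kappa> x * y + x * \<kappa> y" for x y
  proof -
    interpret D: additive "D 1" using dD(1)[of 1] assms diffop_lt_additive by blast
    interpret E: additive "E 1" using dE(1)[of 1] assms diffop_lt_additive by blast
    show ?thesis
      by (simp only: \<kappa>_def commutator_def HS_1_Leibniz[OF D(1) \<open>1 \<le> m\<close>]
          HS_1_Leibniz[OF E(1) \<open>1 \<le> n\<close>] D.add E.add) (simp add: algebra_simps)
  qed
  show ?case
  proof (cases "i = 0 \<or> j = 0")
    \<comment> \<open>A member of index 0 is the identity and commutes with everything, while its
      predecessor is zero. Additivity is needed for \<open>j = 0\<close>, where
      \<open>HS_pred D i\<close> is applied to 0.\<close>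
    case True
    have "HS_pred D i 0 = 0" by (rule additive.zero[OF diffop_lt_additive[OF dD(2)]]) fact
    with True have "(\<lambda>x. commutator (D i) (E j) x - HS_pred D i (HS_pred E j (\<kappa> x))) = (\<lambda>x. 0)"
      using HS_0[OF D(1)] HS_0[OF E(1)] by (auto simp: commutator_def)
    then show ?thesis by (simp only: diffop_lt_zero \<kappa>_def)
  next
    case False
    then obtain M N where ij: "i = Suc M" "j = Suc N" by (meson not0_implies_Suc)
    with less.prems have MN: "Suc M \<le> m" "M \<le> m" "Suc N \<le> n" "N \<le> n" by auto
    let ?D = "D (Suc M)" and ?D' = "D M" and ?D'' = "HS_pred D M"
    let ?E = "E (Suc N)" and ?E' = "E N" and ?E'' = "HS_pred E N"
    have R: "(\<lambda>x. commutator ?D ?E x - ?D' (?E' (\<kappa> x))) \<in> diffop_lt \<phi> (Suc (M + N))"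
    proof (rule diffop_lt_SucI)
      show "k_linear \<phi> (\<lambda>x. commutator ?D ?E x - ?D' (?E' (\<kappa> x)))"
        by (intro k_linear_diff k_linear_commutator k_linear_compose[of \<phi> ?D' "\<lambda>x. ?E' (\<kappa> x)"]
            k_linear_compose[of \<phi> ?E' \<kappa>] diffop_lt_k_linear[OF k2]
            diffop_lt_k_linear[OF dD(1)] diffop_lt_k_linear[OF dE(1)] MN)
      fix a :: 'a
      show "commutator (\<lambda>x. commutator ?D ?E x - ?D' (?E' (\<kappa> x))) (\<lambda>x. a * x) \<in> diffop_lt \<phi> (M + N)"
      proof -
        \<comment> \<open>These are remainders of lower order. \<open>U\<close>, \<open>V\<close>,
          \<open>Y\<close>, \<open>Z\<close> come from the first congruence for D_i, E_j, E_(j-1),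
          D_(i-1); \<open>U\<close> and \<open>V\<close> take any \<open>b\<close> since
          multiplications by \<delta>(a) and \<epsilon>(a) also occur. \<open>X1\<close> and
          \<open>X2\<close> come from the induction hypothesis with one index lowered.\<close>
        define U where "U b = (\<lambda>x. commutator ?D (\<lambda>x. b * x) x - D 1 b * ?D' x)" for b
        define V where "V b = (\<lambda>x. commutator ?E (\<lambda>x. b * x) x - E 1 b * ?E' x)" for b
        define X1 where "X1 = (\<lambda>x. commutator ?D' ?E x - ?D'' (?E' (\<kappa> x)))"
        define X2 where "X2 = (\<lambda>x. commutator ?D ?E' x - ?D' (?E'' (\<kappa> x)))"
        define Y where "Y = (\<lambda>x. commutator ?E' (\<lambda>x. a * x) x - E 1 a * ?E'' x)"
        define Z where "Z = (\<lambda>x. commutator ?D' (\<lambda>x. a * x) x - D 1 a * ?D'' x)"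
        have U: "U b \<in> diffop_lt \<phi> M" and V: "V b \<in> diffop_lt \<phi> N" for b
          unfolding U_def V_def
          using HS_commutator_mult_cong[OF D(1) MN(1)] HS_commutator_mult_cong[OF E(1) MN(3)]
          by simp_all
        have Y: "Y \<in> diffop_lt \<phi> (N - 1)" and Z: "Z \<in> diffop_lt \<phi> (M - 1)"
          unfolding Y_def Z_def
          using HS_commutator_mult_cong[OF D(1) MN(2)] HS_commutator_mult_cong[OF E(1) MN(4)]
          by simp_all
        have X: "X1 \<in> diffop_lt \<phi> (M + N)" "X2 \<in> diffop_lt \<phi> (M + N)"
          unfolding X1_def X2_def \<kappa>_def
          using less.hyps[of M "Suc N"] less.hyps[of "Suc M" N] MN ij by simp_all
        note dD' = dD(1)[OF MN(1)] dD[OF MN(2)] and dE' = dE(1)[OF MN(3)] dE[OF MN(4)]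
        have DE': "(\<lambda>x. ?D' (?E' x)) \<in> diffop_lt \<phi> (Suc (M + N))"
          by (rule diffop_lt_compose'[OF dD'(2) dE'(2)]) simp
        interpret D: additive ?D using dD'(1) diffop_lt_additive by blast
        interpret D': additive ?D' using dD'(2) diffop_lt_additive by blast
        interpret E: additive ?E using dE'(1) diffop_lt_additive by blast
        interpret E': additive ?E' using dE'(2) diffop_lt_additive by blast
        have 1: "commutator (U a) ?E \<in> diffop_lt \<phi> (M + N)"
          by (rule diffop_lt_commutator'[OF U dE'(1)]) simp
        have 2: "commutator ?D (V a) \<in> diffop_lt \<phi> (M + N)"
          by (rule diffop_lt_commutator'[OF dD'(1) V]) simp
        have 3: "(\<lambda>x. V (D 1 a) (?D' x)) \<in> diffop_lt \<phi> (M + N)"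
          by (rule diffop_lt_compose'[OF V dD'(2)]) simp
        have 4: "(\<lambda>x. U (E 1 a) (?E' x)) \<in> diffop_lt \<phi> (M + N)"
          by (rule diffop_lt_compose'[OF U dE'(2)]) simp
        have 5: "commutator (\<lambda>x. ?D' (?E' x)) (\<lambda>x. \<kappa> a * x) \<in> diffop_lt \<phi> (M + N)"
          using diffop_lt_commutator_mult[OF DE'] by simp
        \<comment> \<open>The bound \<open>N - 1\<close> of \<open>Y\<close> truncates at
          \<open>N = 0\<close>, hence the composition lemma for predecessor bounds; the same applies
          to \<open>Z\<close> below.\<close>
        have "(\<lambda>x. Y (\<kappa> x)) \<in> diffop_lt \<phi> N"
          using diffop_lt_compose_pred[OF Y, of \<kappa> 0] k2 by (simp add: numeral_2_eq_2)
        then have 6: "(\<lambda>x. ?D' (Y (\<kappa> x))) \<in> diffop_lt \<phi> (M + N)"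
          by (rule diffop_lt_compose'[OF dD'(2)]) simp
        have "commutator ?D' (\<lambda>x. E 1 a * x) \<in> diffop_lt \<phi> M"
          using diffop_lt_commutator_mult[OF dD'(2)] by simp
        moreover have "(\<lambda>x. ?E'' (\<kappa> x)) \<in> diffop_lt \<phi> (Suc N)"
          by (rule diffop_lt_compose'[OF dE'(3) k2]) simp
        ultimately have 7: "(\<lambda>x. commutator ?D' (\<lambda>x. E 1 a * x) (?E'' (\<kappa> x)))
            \<in> diffop_lt \<phi> (M + N)"
          by (rule diffop_lt_compose') simp
        have "(\<lambda>x. ?E' (\<kappa> x)) \<in> diffop_lt \<phi> (Suc (Suc N))"
          by (rule diffop_lt_compose'[OF dE'(2) k2]) simp
        then have 8: "(\<lambda>x. Z (?E' (\<kappa> x))) \<in> diffop_lt \<phi> (M + N)"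
          by (rule diffop_lt_compose_pred[OF Z])
        have 9: "commutator ?D' ?E' \<in> diffop_lt \<phi> (M + N)"
          by (rule diffop_lt_commutator'[OF dD'(2) dE'(2)]) simp
        \<comment> \<open>Jacobi turns [[D_i, E_j], a] into [[D_i, a], E_j] + [D_i, [E_j, a]], and
          each inner commutator is replaced by its main term plus remainder. The main terms ending
          in \<kappa> cancel against those of [D_(i-1) E_(j-1) \<kappa>, a]. What is left without
          remainders is \<delta>(\<epsilon>(a)) D_(i-1) E_(j-1) - \<epsilon>(\<delta>(a)) E_(j-1)
          D_(i-1) - \<kappa>(a) D_(i-1) E_(j-1), which is \<epsilon>(\<delta>(a)) times
          [D_(i-1), E_(j-1)].\<close>
        have "commutator (\<lambda>x. commutator ?D ?E x - ?D' (?E' (\<kappa> x))) (\<lambda>x. a * x) =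
          (\<lambda>x. commutator (U a) ?E x + commutator ?D (V a) x + D 1 a * X1 x + E 1 a * X2 x
            - V (D 1 a) (?D' x) + U (E 1 a) (?E' x) - commutator (\<lambda>x. ?D' (?E' x)) (\<lambda>x. \<kappa> a * x) x
            - ?D' (Y (\<kappa> x)) - commutator ?D' (\<lambda>x. E 1 a * x) (?E'' (\<kappa> x)) - Z (?E' (\<kappa> x))
            + E 1 (D 1 a) * commutator ?D' ?E' x)" (is "?L = ?R")
        proof
          fix x
          have "\<kappa> a = D 1 (E 1 a) - E 1 (D 1 a)"
            by (simp add: \<kappa>_def commutator_def)
          \<comment> \<open>Multiplied by \<open>?D' (?E' x)\<close>, the value of \<kappa> at
            \<open>a\<close> has the shape in which it enters the expanded identity.\<close>
          then have "(D 1 (E 1 a) - E 1 (D 1 a) - \<kappa> a) * ?D' (?E' x) = 0"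
            by simp
          then show "?L x = ?R x"
            unfolding U_def V_def X1_def X2_def Y_def Z_def commutator_def
            by (simp add: \<kappa>_Leibniz D.add D.diff D'.add D'.diff E.add E.diff E'.add E'.diff
                algebra_simps)
        qed
        also have "\<dots> \<in> diffop_lt \<phi> (M + N)"
          by (intro diffop_lt_add diffop_lt_diff diffop_lt_scale 1 2 3 4 5 6 7 8 9 X)
        finally show ?thesis .
      qed
    qed
    then show ?thesis by (simp add: ij \<kappa>_def)
  qed
qed

section \<open>Families of representatives in the graded ring\<close>

text \<open>Calculations in the graded ring are done on representing operators, one per degree. Each
  degree of a product or bracket is a finite sum, so arbitrary families can be combined.\<close>

definition diffop_family ::
    "('k::{comm_ring,comm_monoid_mult} \<Rightarrow> 'a::{comm_ring,comm_monoid_mult}) \<Rightarrow> (nat \<Rightarrow> 'a \<Rightarrow> 'a) \<Rightarrow> bool"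
  where "diffop_family \<phi> P \<longleftrightarrow> (\<forall>d. P d \<in> diffop \<phi> d)"

definition gr_family ::
    "('k::{comm_ring,comm_monoid_mult} \<Rightarrow> 'a::{comm_ring,comm_monoid_mult}) \<Rightarrow> (nat \<Rightarrow> 'a \<Rightarrow> 'a) \<Rightarrow>
     nat \<Rightarrow> ('a \<Rightarrow> 'a) set"
  where "gr_family \<phi> P = (\<lambda>d. gr_coset \<phi> d (P d))"

definition family_mult :: "(nat \<Rightarrow> 'a \<Rightarrow> 'a::ab_group_add) \<Rightarrow> (nat \<Rightarrow> 'a \<Rightarrow> 'a) \<Rightarrow> nat \<Rightarrow> 'a \<Rightarrow> 'a"
  where "family_mult P Q = (\<lambda>n x. \<Sum>i\<le>n. P i (Q (n - i) x))"

definition family_bracket :: "(nat \<Rightarrow> 'a \<Rightarrow> 'a::ab_group_add) \<Rightarrow> (nat \<Rightarrow> 'a \<Rightarrow> 'a) \<Rightarrow> nat \<Rightarrow> 'a \<Rightarrow> 'a"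
  where "family_bracket P Q = (\<lambda>n x. \<Sum>i\<le>Suc n. commutator (P i) (Q (Suc n - i)) x)"

lemma diffop_familyD: "diffop_family \<phi> P \<Longrightarrow> P d \<in> diffop_lt \<phi> (Suc d)"
  by (simp add: diffop_family_def diffop_def)

lemma diffop_familyI: "(\<And>d. P d \<in> diffop_lt \<phi> (Suc d)) \<Longrightarrow> diffop_family \<phi> P"
  by (simp add: diffop_family_def diffop_def)

lemma diffop_family_additive: "diffop_family \<phi> P \<Longrightarrow> additive (P d)"
  by (rule diffop_lt_additive[OF diffop_familyD])

lemma mem_gr_coset_iff: "P' \<in> gr_coset \<phi> d P \<longleftrightarrow> (\<lambda>x. P' x - P x) \<in> diffop_lt \<phi> d"
proof
  assume "(\<lambda>x. P' x - P x) \<in> diffop_lt \<phi> d"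
  moreover have "P' = (\<lambda>x. P x + (P' x - P x))" by simp
  ultimately show "P' \<in> gr_coset \<phi> d P"
    unfolding gr_coset_def mem_Collect_eq by (intro exI[of _ "\<lambda>x. P' x - P x"] conjI)
qed (auto simp: gr_coset_def)

lemma gr_coset_self: "P \<in> gr_coset \<phi> d P"
  by (simp add: mem_gr_coset_iff)

lemma gr_coset_eq_iff: "gr_coset \<phi> d P = gr_coset \<phi> d Q \<longleftrightarrow> (\<lambda>x. P x - Q x) \<in> diffop_lt \<phi> d"
proof
  assume "gr_coset \<phi> d P = gr_coset \<phi> d Q"
  then show "(\<lambda>x. P x - Q x) \<in> diffop_lt \<phi> d"
    using gr_coset_self[of P \<phi> d] by (simp add: mem_gr_coset_iff)
next
  assume PQ: "(\<lambda>x. P x - Q x) \<in> diffop_lt \<phi> d"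
  have "R \<in> gr_coset \<phi> d P \<longleftrightarrow> R \<in> gr_coset \<phi> d Q" for R
    using diffop_lt_add[OF _ PQ, of "\<lambda>x. R x - P x"] diffop_lt_diff[OF _ PQ, of "\<lambda>x. R x - Q x"]
    by (auto simp: mem_gr_coset_iff)
  then show "gr_coset \<phi> d P = gr_coset \<phi> d Q" by blast
qed

lemma gr_family_apply: "gr_family \<phi> P d = gr_coset \<phi> d (P d)"
  by (simp add: gr_family_def)

lemma gr_family_eq_iff:
  "gr_family \<phi> P = gr_family \<phi> Q \<longleftrightarrow> (\<forall>d. (\<lambda>x. P d x - Q d x) \<in> diffop_lt \<phi> d)"
  by (simp add: gr_family_def fun_eq_iff gr_coset_eq_iff)

lemma mem_Pi_gr_family_iff:
  "P' \<in> Pi UNIV (gr_family \<phi> P) \<longleftrightarrow> (\<forall>d. (\<lambda>x. P' d x - P d x) \<in> diffop_lt \<phi> d)"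
  by (auto simp: gr_family_def mem_gr_coset_iff)

lemma gr_family_self: "P \<in> Pi UNIV (gr_family \<phi> P)"
  by (simp add: mem_Pi_gr_family_iff)

text \<open>Any representatives drawn from the cosets, as in the unions defining the operations,
  again have the right orders.\<close>

lemma diffop_family_cong:
  assumes "diffop_family \<phi> P" "\<And>d. (\<lambda>x. P' d x - P d x) \<in> diffop_lt \<phi> d"
  shows "diffop_family \<phi> P'"
proof (rule diffop_familyI)
  fix d
  have "(\<lambda>x. P' d x - P d x) \<in> diffop_lt \<phi> (Suc d)"
    by (rule diffop_ltD[OF assms(2)]) simp
  from diffop_lt_add[OF this diffop_familyD[OF assms(1)]]
  show "P' d \<in> diffop_lt \<phi> (Suc d)" by simp
qed

lemma carrier_gr_ring_family:
  assumes "F \<in> carrier (gr_ring \<phi>)"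
  obtains P where "diffop_family \<phi> P" "F = gr_family \<phi> P"
proof -
  have "\<forall>d. \<exists>P. P \<in> diffop \<phi> d \<and> F d = gr_coset \<phi> d P"
    using assms by (auto simp: gr_ring_def)
  then obtain P where "\<forall>d. P d \<in> diffop \<phi> d \<and> F d = gr_coset \<phi> d (P d)"
    by metis
  then show thesis
    by (intro that[of P]) (auto simp: diffop_family_def gr_family_def)
qed

lemma symb_eq_gr_family: "symb \<phi> d P = gr_family \<phi> (\<lambda>n. if n = d then P else (\<lambda>x. 0))"
  by (simp add: symb_def gr_family_def)

lemma diffop_family_homogeneous:
  "P \<in> diffop \<phi> d \<Longrightarrow> diffop_family \<phi> (\<lambda>n. if n = d then P else (\<lambda>x. 0))"
  by (simp add: diffop_family_def) (simp add: diffop_def)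

section \<open>Zero, sum, product and bracket through representatives\<close>

lemma gr_zero: "\<zero>\<^bsub>gr_ring \<phi>\<^esub> = gr_family \<phi> (\<lambda>n x. 0)"
  by (auto simp: gr_ring_def gr_family_def gr_coset_def)

text \<open>This collapses the unions over representatives once the resulting coset is independent
  of the choice; \<open>a\<close> and \<open>b\<close> witness that the unions are nonempty.\<close>

lemma UN_UN_constant:
  assumes "a \<in> A" "b \<in> B" "\<And>a b. \<lbrakk>a \<in> A; b \<in> B\<rbrakk> \<Longrightarrow> f a b = C"
  shows "(\<Union>a\<in>A. \<Union>b\<in>B. f a b) = C"
proof -
  have "(\<Union>a\<in>A. \<Union>b\<in>B. f a b) = (\<Union>a\<in>A. \<Union>b\<in>B. C)"
    by (intro SUP_cong refl assms(3))
  then show ?thesis using assms(1,2) by auto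
qed

lemma gr_add:
  "gr_family \<phi> P \<oplus>\<^bsub>gr_ring \<phi>\<^esub> gr_family \<phi> Q = gr_family \<phi> (\<lambda>n x. P n x + Q n x)"
proof
  fix n
  have "gr_coset \<phi> n (\<lambda>x. P' x + Q' x) = gr_coset \<phi> n (\<lambda>x. P n x + Q n x)"
    if "P' \<in> gr_coset \<phi> n (P n)" "Q' \<in> gr_coset \<phi> n (Q n)" for P' Q'
  proof -
    have "(\<lambda>x. (P' x + Q' x) - (P n x + Q n x)) = (\<lambda>x. (P' x - P n x) + (Q' x - Q n x))"
      by (simp add: algebra_simps)
    also have "\<dots> \<in> diffop_lt \<phi> n"
      using that by (intro diffop_lt_add) (simp_all add: mem_gr_coset_iff)
    finally show ?thesis by (simp add: gr_coset_eq_iff)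
  qed
  then have "(\<Union>P'\<in>gr_coset \<phi> n (P n). \<Union>Q'\<in>gr_coset \<phi> n (Q n). gr_coset \<phi> n (\<lambda>x. P' x + Q' x))
      = gr_coset \<phi> n (\<lambda>x. P n x + Q n x)"
    by (rule UN_UN_constant[OF gr_coset_self gr_coset_self])
  then show "(gr_family \<phi> P \<oplus>\<^bsub>gr_ring \<phi>\<^esub> gr_family \<phi> Q) n = gr_family \<phi> (\<lambda>n x. P n x + Q n x) n"
    by (simp add: gr_ring_def gr_family_def)
qed

text \<open>Telescoping: P'Q' - PQ = (P' - P) Q' + P (Q' - Q), and in each summand one factor has
  dropped in order.\<close>

lemma family_mult_cong:
  assumes "diffop_family \<phi> P" "diffop_family \<phi> Q"
    and P': "P' \<in> Pi UNIV (gr_family \<phi> P)" and Q': "Q' \<in> Pi UNIV (gr_family \<phi> Q)"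
  shows "gr_coset \<phi> n (family_mult P' Q' n) = gr_coset \<phi> n (family_mult P Q n)"
proof -
  have P'': "(\<lambda>x. P' i x - P i x) \<in> diffop_lt \<phi> i" and Q'': "(\<lambda>x. Q' i x - Q i x) \<in> diffop_lt \<phi> i"
    for i using P' Q' by (simp_all add: mem_Pi_gr_family_iff)
  have "(\<lambda>x. family_mult P' Q' n x - family_mult P Q n x) =
      (\<lambda>x. \<Sum>i\<le>n. (P' i (Q' (n - i) x) - P i (Q' (n - i) x)) + P i (Q' (n - i) x - Q (n - i) x))"
    by (simp add: family_mult_def sum_subtractf additive.diff[OF diffop_family_additive[OF assms(1)]])
  also have "\<dots> \<in> diffop_lt \<phi> n"
  proof (intro diffop_lt_sum diffop_lt_add)
    fix i assume "i \<in> {..n}"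
    then show "(\<lambda>x. P' i (Q' (n - i) x) - P i (Q' (n - i) x)) \<in> diffop_lt \<phi> n"
      using diffop_lt_compose'[OF P''[of i] diffop_familyD[OF diffop_family_cong[OF assms(2) Q''], of "n - i"]]
      by simp
    show "(\<lambda>x. P i (Q' (n - i) x - Q (n - i) x)) \<in> diffop_lt \<phi> n"
      by (rule diffop_lt_compose'[OF diffop_familyD[OF assms(1)] Q''[of "n - i"]]) (use \<open>i \<in> {..n}\<close> in simp)
  qed
  finally show ?thesis by (simp add: gr_coset_eq_iff)
qed

lemma gr_mult:
  assumes "diffop_family \<phi> P" "diffop_family \<phi> Q"
  shows "gr_family \<phi> P \<otimes>\<^bsub>gr_ring \<phi>\<^esub> gr_family \<phi> Q = gr_family \<phi> (family_mult P Q)"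
proof
  fix n
  have "(\<Union>P'\<in>Pi UNIV (gr_family \<phi> P). \<Union>Q'\<in>Pi UNIV (gr_family \<phi> Q). gr_coset \<phi> n (family_mult P' Q' n))
      = gr_coset \<phi> n (family_mult P Q n)"
    by (rule UN_UN_constant[OF gr_family_self gr_family_self family_mult_cong[OF assms]])
  then show "(gr_family \<phi> P \<otimes>\<^bsub>gr_ring \<phi>\<^esub> gr_family \<phi> Q) n = gr_family \<phi> (family_mult P Q) n"
    by (simp add: gr_ring_def gr_family_apply family_mult_def)
qed

text \<open>The same telescoping for commutators. The strict bounds of the two arguments add up to
  n+2, and a commutator lowers this sum by 2.\<close>

lemma family_bracket_cong:
  assumes "diffop_family \<phi> P" "diffop_family \<phi> Q"
    and P': "P' \<in> Pi UNIV (gr_family \<phi> P)" and Q': "Q' \<in> Pi UNIV (gr_family \<phi> Q)"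
  shows "gr_coset \<phi> n (family_bracket P' Q' n) = gr_coset \<phi> n (family_bracket P Q n)"
proof -
  have P'': "(\<lambda>x. P' i x - P i x) \<in> diffop_lt \<phi> i" and Q'': "(\<lambda>x. Q' i x - Q i x) \<in> diffop_lt \<phi> i"
    for i using P' Q' by (simp_all add: mem_Pi_gr_family_iff)
  have fQ': "diffop_family \<phi> Q'"
    by (rule diffop_family_cong[OF assms(2) Q''])
  have "(\<lambda>x. family_bracket P' Q' n x - family_bracket P Q n x) =
      (\<lambda>x. \<Sum>i\<le>Suc n. commutator (\<lambda>x. P' i x - P i x) (Q' (Suc n - i)) x
         + commutator (P i) (\<lambda>x. Q' (Suc n - i) x - Q (Suc n - i) x) x)"
    unfolding family_bracket_def sum_subtractf[symmetric] commutator_def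
    by (intro ext sum.cong refl) (simp add: algebra_simps
        additive.diff[OF diffop_family_additive[OF assms(1)]] additive.diff[OF diffop_family_additive[OF fQ']])
  also have "\<dots> \<in> diffop_lt \<phi> n"
  proof (intro diffop_lt_sum diffop_lt_add)
    fix i assume i: "i \<in> {..Suc n}"
    show "commutator (\<lambda>x. P' i x - P i x) (Q' (Suc n - i)) \<in> diffop_lt \<phi> n"
      by (rule diffop_lt_commutator'[OF P'' diffop_familyD[OF fQ']]) (use i in simp)
    show "commutator (P i) (\<lambda>x. Q' (Suc n - i) x - Q (Suc n - i) x) \<in> diffop_lt \<phi> n"
      by (rule diffop_lt_commutator'[OF diffop_familyD[OF assms(1)] Q'']) (use i in simp)
  qed
  finally show ?thesis by (simp add: gr_coset_eq_iff)
qed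

lemma gr_bracket_family:
  assumes "diffop_family \<phi> P" "diffop_family \<phi> Q"
  shows "gr_bracket \<phi> (gr_family \<phi> P) (gr_family \<phi> Q) = gr_family \<phi> (family_bracket P Q)"
proof
  fix n
  have "(\<Union>P'\<in>Pi UNIV (gr_family \<phi> P). \<Union>Q'\<in>Pi UNIV (gr_family \<phi> Q). gr_coset \<phi> n (family_bracket P' Q' n))
      = gr_coset \<phi> n (family_bracket P Q n)"
    by (rule UN_UN_constant[OF gr_family_self gr_family_self family_bracket_cong[OF assms]])
  then show "gr_bracket \<phi> (gr_family \<phi> P) (gr_family \<phi> Q) n = gr_family \<phi> (family_bracket P Q) n"
    by (simp only: gr_bracket_def gr_family_apply family_bracket_def)
qed

section \<open>Closure and biderivation identities for families\<close>

lemma diffop_family_add: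
  "\<lbrakk>diffop_family \<phi> P; diffop_family \<phi> Q\<rbrakk> \<Longrightarrow> diffop_family \<phi> (\<lambda>n x. P n x + Q n x)"
  by (simp add: diffop_family_def diffop_def diffop_lt_add)

lemma diffop_family_mult:
  assumes "diffop_family \<phi> P" "diffop_family \<phi> Q"
  shows "diffop_family \<phi> (family_mult P Q)"
  unfolding family_mult_def
proof (intro diffop_familyI diffop_lt_sum)
  fix n i assume "i \<in> {..n::nat}"
  then show "(\<lambda>x. P i (Q (n - i) x)) \<in> diffop_lt \<phi> (Suc n)"
    using diffop_lt_compose'[OF assms[THEN diffop_familyD]] by simp
qed

lemma diffop_family_bracket:
  assumes "diffop_family \<phi> P" "diffop_family \<phi> Q"
  shows "diffop_family \<phi> (family_bracket P Q)"
  unfolding family_bracket_def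
proof (intro diffop_familyI diffop_lt_sum)
  fix n i assume "i \<in> {..Suc n}"
  then show "commutator (P i) (Q (Suc n - i)) \<in> diffop_lt \<phi> (Suc n)"
    using diffop_lt_commutator'[OF assms[THEN diffop_familyD]] by simp
qed

lemma family_bracket_add:
  assumes "diffop_family \<phi> R"
  shows "family_bracket (\<lambda>n x. P n x + Q n x) R = (\<lambda>n x. family_bracket P R n x + family_bracket Q R n x)"
  unfolding family_bracket_def sum.distrib[symmetric] commutator_def
  by (intro ext sum.cong refl)
    (simp add: algebra_simps additive.add[OF diffop_family_additive[OF assms]])

lemma sum_atMost_rev: "(\<Sum>i\<le>n::nat. f i) = (\<Sum>i\<le>n. f (n - i))"
  by (rule sum.reindex_bij_witness[of _ "\<lambda>i. n - i" "\<lambda>i. n - i"]) auto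

lemma family_bracket_skew: "family_bracket P Q = (\<lambda>n x. - family_bracket Q P n x)"
proof (intro ext)
  fix n x
  have "family_bracket P Q n x = (\<Sum>i\<le>Suc n. commutator (P (Suc n - i)) (Q (Suc n - (Suc n - i))) x)"
    unfolding family_bracket_def by (rule sum_atMost_rev)
  also have "\<dots> = (\<Sum>i\<le>Suc n. - commutator (Q i) (P (Suc n - i)) x)"
    by (rule sum.cong) (auto simp: commutator_def)
  finally show "family_bracket P Q n x = - family_bracket Q P n x"
    by (simp add: family_bracket_def sum_negf del: sum.atMost_Suc)
qed

text \<open>Both sides add \<open>f a b (n - a - b)\<close> over all a, b with a + b \<le> k. The
  limit \<open>k\<close> is kept apart from \<open>n\<close> so that induction on \<open>k\<close>
  leaves \<open>n\<close> alone.\<close>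

lemma sum_triple_reindex:
  fixes f :: "nat \<Rightarrow> nat \<Rightarrow> nat \<Rightarrow> 'b::comm_monoid_add"
  shows "(\<Sum>i\<le>k. \<Sum>j\<le>i. f j (i - j) (n - i)) = (\<Sum>j\<le>k. \<Sum>i\<le>k - j. f j i (n - j - i))"
  by (induction k) (simp_all add: Suc_diff_le sum.distrib add.assoc)

text \<open>The sum runs over all a + b + c = n, a range symmetric in b and c.\<close>

lemma sum_triple_swap:
  fixes f :: "nat \<Rightarrow> nat \<Rightarrow> nat \<Rightarrow> 'b::comm_monoid_add"
  shows "(\<Sum>i\<le>n. \<Sum>j\<le>i. f j (i - j) (n - i)) = (\<Sum>i\<le>n. \<Sum>j\<le>i. f j (n - i) (i - j))"
proof -
  have "(\<Sum>i\<le>n. \<Sum>j\<le>i. f j (i - j) (n - i)) = (\<Sum>j\<le>n. \<Sum>i\<le>n - j. f j i (n - j - i))"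
    by (rule sum_triple_reindex)
  also have "\<dots> = (\<Sum>j\<le>n. \<Sum>i\<le>n - j. f j (n - j - i) i)"
    by (subst sum_atMost_rev) (rule sum.cong, auto)
  also have "\<dots> = (\<Sum>i\<le>n. \<Sum>j\<le>i. f j (n - i) (i - j))"
    by (rule sum_triple_reindex[of "\<lambda>a b c. f a c b", symmetric])
  finally show ?thesis .
qed

text \<open>This is [PQ, R] = [P, R] Q + P [Q, R] summed over index triples of total n+1; the
  reindexing puts the two indices under a bracket into one inner sum.\<close>

lemma family_bracket_Leibniz:
  assumes "diffop_family \<phi> P" "diffop_family \<phi> Q" "diffop_family \<phi> R"
  shows "family_bracket (family_mult P Q) R =
    (\<lambda>n x. family_mult (family_bracket P R) Q n x + family_mult P (family_bracket Q R) n x)"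
proof (intro ext)
  fix n x
  let ?N = "Suc n"
  \<comment> \<open>The bracket of families starts with index pairs of total 1, whereas the triples
    also contain the pair (0, 0); it contributes nothing, as operators of order zero
    commute.\<close>
  have "commutator (A 0) (R 0) = (\<lambda>x. 0)" if "diffop_family \<phi> A" for A
    using diffop_lt_commutator[OF diffop_familyD[OF that, of 0] diffop_familyD[OF assms(3), of 0]]
    by simp
  note zero = this[OF assms(1)] this[OF assms(2)]
  note addP = additive.sum[OF diffop_family_additive[OF assms(1)]] additive.diff[OF diffop_family_additive[OF assms(1)]]
    additive.zero[OF diffop_family_additive[OF assms(1)]]
  note addR = additive.sum[OF diffop_family_additive[OF assms(3)]]
  have "family_bracket (family_mult P Q) R n x =
      (\<Sum>i\<le>?N. \<Sum>j\<le>i. commutator (P j) (R (?N - i)) (Q (i - j) x)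
         + P j (commutator (Q (i - j)) (R (?N - i)) x))"
    unfolding family_bracket_def family_mult_def commutator_def
    by (intro sum.cong refl) (simp add: addP addR sum_subtractf[symmetric])
  also have "\<dots> = (\<Sum>i\<le>?N. \<Sum>j\<le>i. commutator (P j) (R (?N - i)) (Q (i - j) x)) +
      (\<Sum>i\<le>?N. \<Sum>j\<le>i. P j (commutator (Q (i - j)) (R (?N - i)) x))"
    by (simp only: sum.distrib)
  also have "(\<Sum>i\<le>?N. \<Sum>j\<le>i. commutator (P j) (R (?N - i)) (Q (i - j) x)) =
      (\<Sum>i\<le>?N. \<Sum>j\<le>i. commutator (P j) (R (i - j)) (Q (?N - i) x))"
    by (rule sum_triple_swap[of "\<lambda>a b c. commutator (P a) (R c) (Q b x)"])
  also have "\<dots> = family_mult (family_bracket P R) Q n x"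
    unfolding family_mult_def family_bracket_def
    by (subst sum.atMost_Suc_shift) (simp add: zero)
  also have "(\<Sum>i\<le>?N. \<Sum>j\<le>i. P j (commutator (Q (i - j)) (R (?N - i)) x)) =
      (\<Sum>j\<le>?N. \<Sum>i\<le>?N - j. P j (commutator (Q i) (R (?N - j - i)) x))"
    by (rule sum_triple_reindex[of "\<lambda>a b c. P a (commutator (Q b) (R c) x)"])
  also have "\<dots> = (\<Sum>j\<le>n. \<Sum>i\<le>?N - j. P j (commutator (Q i) (R (?N - j - i)) x))"
    by (simp add: zero addP)
  also have "\<dots> = family_mult P (family_bracket Q R) n x"
    unfolding family_mult_def family_bracket_def
    by (intro sum.cong refl) (simp add: addP Suc_diff_le del: sum.atMost_Suc)
  finally show "family_bracket (family_mult P Q) R n x =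
    family_mult (family_bracket P R) Q n x + family_mult P (family_bracket Q R) n x" .
qed

section \<open>Products and brackets of homogeneous symbols\<close>

lemma symb_mult:
  assumes "P \<in> diffop \<phi> d" "Q \<in> diffop \<phi> e"
  shows "symb \<phi> d P \<otimes>\<^bsub>gr_ring \<phi>\<^esub> symb \<phi> e Q = symb \<phi> (d + e) (\<lambda>x. P (Q x))"
proof -
  \<comment> \<open>Outside degree \<open>e\<close> the representative of the second symbol is zero,
    and \<open>P\<close> has to preserve that.\<close>
  have "P 0 = 0"
    using assms(1) additive.zero[OF diffop_lt_additive] by (auto simp: diffop_def)
  then have "(\<Sum>i\<le>n. (if i = d then P else (\<lambda>x. 0)) ((if n - i = e then Q else (\<lambda>x. 0)) x)) =
      (if n = d + e then P (Q x) else 0)" for n x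
    by (subst sum.mono_neutral_right[of _ "{..n} \<inter> {d}"]) (auto simp: Int_insert_right)
  then have "family_mult (\<lambda>n. if n = d then P else (\<lambda>x. 0)) (\<lambda>n. if n = e then Q else (\<lambda>x. 0)) =
      (\<lambda>n. if n = d + e then \<lambda>x. P (Q x) else (\<lambda>x. 0))"
    by (auto simp: family_mult_def fun_eq_iff)
  then show ?thesis
    using gr_mult[OF assms[THEN diffop_family_homogeneous]] by (simp add: symb_eq_gr_family)
qed

text \<open>For \<open>d = e = 0\<close> both sides vanish, because operators of order zero commute.\<close>

lemma symb_bracket:
  assumes "P \<in> diffop \<phi> d" "Q \<in> diffop \<phi> e"
  shows "gr_bracket \<phi> (symb \<phi> d P) (symb \<phi> e Q) = symb \<phi> (d + e - 1) (commutator P Q)"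
proof -
  have PQ: "P 0 = 0" "Q 0 = 0"
    using assms additive.zero[OF diffop_lt_additive] by (auto simp: diffop_def)
  have comm0: "commutator P Q = (\<lambda>x. 0)" if "d + e = 0"
    using assms diffop_lt_commutator[of P \<phi> 1 Q 1] that by (simp add: diffop_def)
  have "(\<Sum>i\<le>Suc n. commutator (if i = d then P else (\<lambda>x. 0)) (if Suc n - i = e then Q else (\<lambda>x. 0)) x) =
      (if Suc n = d + e then commutator P Q x else 0)" for n x
    using PQ by (subst sum.mono_neutral_right[of _ "{..Suc n} \<inter> {d}"]) (auto simp: Int_insert_right commutator_def)
  then have "family_bracket (\<lambda>n. if n = d then P else (\<lambda>x. 0)) (\<lambda>n. if n = e then Q else (\<lambda>x. 0)) =
      (\<lambda>n. if n = d + e - 1 then commutator P Q else (\<lambda>x. 0))"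
    using comm0 by (cases "d + e") (auto simp: family_bracket_def fun_eq_iff simp del: sum.atMost_Suc)
  then show ?thesis
    using gr_bracket_family[OF assms[THEN diffop_family_homogeneous]] by (simp add: symb_eq_gr_family)
qed

lemma symb_cong: "(\<lambda>x. P x - Q x) \<in> diffop_lt \<phi> d \<Longrightarrow> symb \<phi> d P = symb \<phi> d Q"
  by (simp add: symb_def fun_eq_iff gr_coset_eq_iff)

section \<open>Biderivation laws in the graded ring\<close>

lemma gr_bracket_add:
  assumes "F \<in> carrier (gr_ring \<phi>)" "G \<in> carrier (gr_ring \<phi>)" "H \<in> carrier (gr_ring \<phi>)"
  shows "gr_bracket \<phi> (F \<oplus>\<^bsub>gr_ring \<phi>\<^esub> G) H = gr_bracket \<phi> F H \<oplus>\<^bsub>gr_ring \<phi>\<^esub> gr_bracket \<phi> G H"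
proof -
  obtain P Q R where PQR: "diffop_family \<phi> P" "diffop_family \<phi> Q" "diffop_family \<phi> R"
    and "F = gr_family \<phi> P" "G = gr_family \<phi> Q" "H = gr_family \<phi> R"
    using assms carrier_gr_ring_family by metis
  then show ?thesis
    by (simp add: gr_add gr_bracket_family diffop_family_add family_bracket_add[OF PQR(3)])
qed

lemma gr_bracket_Leibniz:
  assumes "F \<in> carrier (gr_ring \<phi>)" "G \<in> carrier (gr_ring \<phi>)" "H \<in> carrier (gr_ring \<phi>)"
  shows "gr_bracket \<phi> (F \<otimes>\<^bsub>gr_ring \<phi>\<^esub> G) H =
    (gr_bracket \<phi> F H \<otimes>\<^bsub>gr_ring \<phi>\<^esub> G) \<oplus>\<^bsub>gr_ring \<phi>\<^esub> (F \<otimes>\<^bsub>gr_ring \<phi>\<^esub> gr_bracket \<phi> G H)"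
proof -
  obtain P Q R where PQR: "diffop_family \<phi> P" "diffop_family \<phi> Q" "diffop_family \<phi> R"
    and "F = gr_family \<phi> P" "G = gr_family \<phi> Q" "H = gr_family \<phi> R"
    using assms carrier_gr_ring_family by metis
  then show ?thesis
    by (simp add: gr_add gr_mult gr_bracket_family diffop_family_mult diffop_family_bracket
        family_bracket_Leibniz[OF PQR])
qed

text \<open>Skew-symmetry is phrased through a vanishing sum, so that it can be transported along
  \<theta> without additive inverses in the graded ring.\<close>

lemma gr_bracket_skew:
  assumes "F \<in> carrier (gr_ring \<phi>)" "G \<in> carrier (gr_ring \<phi>)" "H \<in> carrier (gr_ring \<phi>)"
    and "H \<oplus>\<^bsub>gr_ring \<phi>\<^esub> gr_bracket \<phi> F G = \<zero>\<^bsub>gr_ring \<phi>\<^esub>"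
  shows "H = gr_bracket \<phi> G F"
proof -
  obtain P Q R where PQR: "diffop_family \<phi> P" "diffop_family \<phi> Q" "diffop_family \<phi> R"
    and FGH: "F = gr_family \<phi> P" "G = gr_family \<phi> Q" "H = gr_family \<phi> R"
    using assms carrier_gr_ring_family by metis
  have "gr_family \<phi> R = gr_family \<phi> (family_bracket Q P)"
    using assms(4)
    by (simp add: FGH gr_bracket_family PQR gr_add gr_zero gr_family_eq_iff
        family_bracket_skew[of Q P])
  then show ?thesis
    by (simp add: FGH gr_bracket_family PQR)
qed

section \<open>Polynomials underlying the divided power algebra\<close>

lemma dp_poly_ring_simps [simp]:
  "monoid.mult (dp_poly_ring L) = (*)" "add (dp_poly_ring L) = (+)"
  "one (dp_poly_ring L) = dp_const 1" "zero (dp_poly_ring L) = 0"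
  by (simp_all add: dp_poly_ring_def dp_const_def)

lemma carrier_dp_poly_ring_iff:
  "p \<in> carrier (dp_poly_ring L) \<longleftrightarrow> (\<forall>t\<in>Poly_Mapping.keys p. Poly_Mapping.keys t \<subseteq> L \<times> UNIV)"
  by (simp add: dp_poly_ring_def)

lemma dp_const_carrier: "dp_const a \<in> carrier (dp_poly_ring L)"
  by (auto simp: carrier_dp_poly_ring_iff dp_const_def)

lemma dp_var_carrier: "l \<in> L \<Longrightarrow> dp_var l n \<in> carrier (dp_poly_ring L)"
  by (auto simp: carrier_dp_poly_ring_iff dp_var_def split: if_splits)

lemma dp_poly_add_carrier:
  "\<lbrakk>p \<in> carrier (dp_poly_ring L); q \<in> carrier (dp_poly_ring L)\<rbrakk> \<Longrightarrow> p + q \<in> carrier (dp_poly_ring L)"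
  using keys_add[of p q] by (auto simp: carrier_dp_poly_ring_iff)

lemma dp_poly_mult_carrier:
  assumes "p \<in> carrier (dp_poly_ring L)" "q \<in> carrier (dp_poly_ring L)"
  shows "p * q \<in> carrier (dp_poly_ring L)"
  unfolding carrier_dp_poly_ring_iff
proof
  fix t assume "t \<in> Poly_Mapping.keys (p * q)"
  then obtain u v where "t = u + v" "u \<in> Poly_Mapping.keys p" "v \<in> Poly_Mapping.keys q"
    using keys_mult[of p q] by blast
  then show "Poly_Mapping.keys t \<subseteq> L \<times> UNIV"
    using assms keys_add[of u v] unfolding carrier_dp_poly_ring_iff by blast
qed

lemma update_eq_single_add:
  fixes f :: "'b \<Rightarrow>\<^sub>0 'c::monoid_add"
  assumes "t \<notin> Poly_Mapping.keys f"
  shows "Poly_Mapping.update t c f = Poly_Mapping.single t c + f"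
  using assms by (intro poly_mapping_eqI) (auto simp: lookup_update lookup_add lookup_single in_keys_iff)

text \<open>Since \<open>0 = 1\<close> is allowed among the coefficients, the unit law is checked on
  single terms and extended by additivity.\<close>

lemma dp_const_1_mult: "dp_const 1 * p = p"
proof -
  have "dp_const 1 * Poly_Mapping.single t c = Poly_Mapping.single t c" for t :: "'a dp_monom" and c :: 'a
    by (simp add: dp_const_def mult_single)
  then show ?thesis
    by (induction p rule: update_induct) (simp_all add: distrib_left update_eq_single_add)
qed

lemma cring_dp_poly_ring: "cring (dp_poly_ring L)"
proof (rule cringI)
  show "abelian_group (dp_poly_ring L)"
  proof (rule abelian_groupI)
    fix p assume "p \<in> carrier (dp_poly_ring L)"
    then have "- p \<in> carrier (dp_poly_ring L)"
      by (simp add: carrier_dp_poly_ring_iff)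
    then show "\<exists>q\<in>carrier (dp_poly_ring L). q \<oplus>\<^bsub>dp_poly_ring L\<^esub> p = \<zero>\<^bsub>dp_poly_ring L\<^esub>"
      by (intro bexI[of _ "- p"]) auto
  qed (auto simp: dp_poly_add_carrier add_ac, simp add: carrier_dp_poly_ring_iff)
  show "comm_monoid (dp_poly_ring L)"
    by (rule comm_monoidI) (auto simp: dp_poly_mult_carrier dp_const_carrier mult.assoc dp_const_1_mult, simp add: mult.commute)
qed (auto simp: distrib_right)

text \<open>Constants and variables generate the carrier as a ring: first powers of a variable, then
  monomials, then sums of terms. The rule later carries bracket compatibility from generators to the
  whole algebra.\<close>

lemma dp_poly_induct [consumes 1, case_names const var add mult]:
  assumes p: "p \<in> carrier (dp_poly_ring L)"
    and const: "\<And>a. S (dp_const a)"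
    and var: "\<And>l n. l \<in> L \<Longrightarrow> S (dp_var l n)"
    and add: "\<And>p q. \<lbrakk>p \<in> carrier (dp_poly_ring L); q \<in> carrier (dp_poly_ring L); S p; S q\<rbrakk> \<Longrightarrow> S (p + q)"
    and mult: "\<And>p q. \<lbrakk>p \<in> carrier (dp_poly_ring L); q \<in> carrier (dp_poly_ring L); S p; S q\<rbrakk> \<Longrightarrow> S (p * q)"
  shows "S p"
proof -
  \<comment> \<open>Membership in the carrier is carried along because the cases \<open>add\<close>
    and \<open>mult\<close> ask for it.\<close>
  define T where "T p \<longleftrightarrow> p \<in> carrier (dp_poly_ring L) \<and> S p" for p
  have T_mult: "T (p * q)" if "T p" "T q" for p q
    using that mult dp_poly_mult_carrier by (auto simp: T_def)
  have T_const: "T (dp_const a)" for a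
    by (simp add: T_def const dp_const_carrier)
  have T_pow: "T (Poly_Mapping.single (Poly_Mapping.single (l, n) b) 1)" if "l \<in> L" for l n b
  proof (induction b)
    case 0
    then show ?case using T_const[of 1] by (simp add: dp_const_def)
  next
    case (Suc b)
    have "T (dp_var l n)" using that by (simp add: T_def var dp_var_carrier)
    from T_mult[OF this Suc] show ?case
      by (simp add: dp_var_def mult_single single_add[symmetric])
  qed
  have T_monom: "T (Poly_Mapping.single t 1)" if "Poly_Mapping.keys t \<subseteq> L \<times> UNIV" for t
    using that
  proof (induction t rule: update_induct)
    case const
    then show ?case using T_const[of 1] by (simp add: dp_const_def)
  next
    case (update t v b)
    obtain l n where v: "v = (l, n)" by fastforce
    with update.prems update.hyps have "l \<in> L" "Poly_Mapping.keys t \<subseteq> L \<times> UNIV"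
      by (auto simp: keys_update)
    from T_mult[OF T_pow[OF this(1), of n b] update.IH[OF this(2)]]
    show ?case using update.hyps(1) by (simp add: v update_eq_single_add mult_single)
  qed
  have "T p"
    using p
  proof (induction p rule: update_induct)
    case const
    then show ?case using T_const[of 0] by (simp add: dp_const_def)
  next
    case (update p t c)
    from update.prems update.hyps have "Poly_Mapping.keys t \<subseteq> L \<times> UNIV" and p: "p \<in> carrier (dp_poly_ring L)"
      by (auto simp: keys_update carrier_dp_poly_ring_iff)
    from T_mult[OF T_const[of c] T_monom[OF this(1)]] have "T (Poly_Mapping.single t c)"
      by (simp add: dp_const_def mult_single)
    with update.IH[OF p] show ?case
      using update.hyps(1) by (simp add: update_eq_single_add T_def add dp_poly_add_carrier)
  qed
  then show ?thesis by (simp add: T_def)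
qed

text \<open>
  If some relation were outside the carrier, \<open>genideal\<close> would be an empty intersection, so all classes
  would coincide, and \<open>\<theta>\<close> would force \<open>1 = 0\<close> in \<open>A\<close>.
\<close>

lemma dp_relations_carrier:
  fixes \<phi> :: "'k::{comm_ring,comm_monoid_mult} \<Rightarrow> 'a::{comm_ring,comm_monoid_mult}"
  assumes "graded_algebra_map \<phi> L \<theta>"
  shows "dp_relations L \<subseteq> carrier (dp_poly_ring L)"
proof (rule ccontr)
  assume not_subset: "\<not> ?thesis"
  have "dp_ideal L = \<Inter> {}"
    unfolding dp_ideal_def genideal_def
    using not_subset additive_subgroup.a_subset ideal.axioms(1) by (intro arg_cong[of _ _ Inter]) blast
  then have "Gamma_class L p = UNIV" for p
    by (auto simp: Gamma_class_def a_r_coset_def r_coset_def) (metis diff_add_cancel)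
  then have "gr_const \<phi> (1 :: 'a) = gr_const \<phi> 0"
    using assms by (metis Gamma_const_def graded_algebra_map_def)
  then have "gr_coset \<phi> 0 (\<lambda>x :: 'a. x) = gr_coset \<phi> 0 (\<lambda>x. 0)"
    by (simp add: gr_const_def symb_def fun_eq_iff) (metis)
  \<comment> \<open>In degree 0 the cosets are singletons, so the identity is the zero map.\<close>
  then have "x = 0" for x :: 'a
    \<comment> \<open>Both cosets are taken modulo \<open>diffop_lt \<phi> 0\<close>, which contains
      only the zero map.\<close>
    by (simp add: gr_coset_eq_iff fun_eq_iff)
  then have "p = 0" for p :: "'a dp_poly"
    by (intro poly_mapping_eqI) metis
  then have "p \<in> carrier (dp_poly_ring L)" for p :: "'a dp_poly"
    by (metis dp_const_carrier)
  with not_subset show False by blast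
qed

section \<open>Compatibility with the brackets\<close>

text \<open>The common core of both maps. One integral must serve all degrees up to
  \<open>n\<close>, because the bracket formulas relate D_m to D_(m-1).\<close>

lemma poisson_map_of_integrals:
  fixes \<phi> :: "'k::{comm_ring,comm_monoid_mult} \<Rightarrow> 'a::{comm_ring,comm_monoid_mult}"
  assumes B: "is_Gamma_bracket \<phi> L B" and \<theta>: "graded_algebra_map \<phi> L \<theta>"
    and integral: "\<And>\<delta> n. \<lbrakk>\<delta> \<in> L; 1 \<le> n\<rbrakk> \<Longrightarrow>
      \<exists>D\<in>HS \<phi> (enat n). D 1 = \<delta> \<and> (\<forall>i\<in>{1..n}. \<theta> (dpow L i \<delta>) = symb \<phi> i (D i))"
  shows "poisson_map (Gamma L) (\<lambda>c. Gamma_const L (\<phi> c)) B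
    (gr_ring \<phi>) (\<lambda>c. gr_const \<phi> (\<phi> c)) (gr_bracket \<phi>) \<theta>"
proof -

  \<comment> \<open>Ring structure and generators of the quotient\<close>
  let ?P = "dp_poly_ring L" and ?\<Gamma> = "Gamma L" and ?G = "gr_ring \<phi>"
  interpret P: cring ?P by (rule cring_dp_poly_ring)
  have relations: "dp_relations L \<subseteq> carrier ?P"
    by (rule dp_relations_carrier[OF \<theta>])
  interpret I: ideal "dp_ideal L" ?P
    unfolding dp_ideal_def by (rule P.genideal_ideal[OF relations])
  interpret \<Gamma>: ring ?\<Gamma>
    unfolding Gamma_def by (rule I.quotient_is_ring)
  have hom_class: "Gamma_class L \<in> ring_hom ?P ?\<Gamma>"
    unfolding Gamma_def Gamma_class_def by (rule I.rcos_ring_hom)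
  have class_carrier: "Gamma_class L p \<in> carrier ?\<Gamma>" if "p \<in> carrier ?P" for p
    using ring_hom_closed[OF hom_class that] .
  have class_add: "Gamma_class L (p + q) = Gamma_class L p \<oplus>\<^bsub>?\<Gamma>\<^esub> Gamma_class L q"
    and class_mult: "Gamma_class L (p * q) = Gamma_class L p \<otimes>\<^bsub>?\<Gamma>\<^esub> Gamma_class L q"
    if "p \<in> carrier ?P" "q \<in> carrier ?P" for p q
    using ring_hom_add[OF hom_class that] ring_hom_mult[OF hom_class that] by simp_all
  have class_surj: "\<exists>p\<in>carrier ?P. x = Gamma_class L p" if "x \<in> carrier ?\<Gamma>" for x
    using that by (auto simp: Gamma_def Gamma_class_def FactRing_def A_RCOSETS_def')
  have const_carrier: "Gamma_const L a \<in> carrier ?\<Gamma>" for a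
    by (simp add: Gamma_const_def class_carrier dp_const_carrier)
  have dpow_carrier: "dpow L n l \<in> carrier ?\<Gamma>" if "l \<in> L" for l n
    using that by (simp add: dpow_def class_carrier dp_var_carrier)
  have one_\<Gamma>: "\<one>\<^bsub>?\<Gamma>\<^esub> = Gamma_const L 1"
    using ring_hom_one[OF hom_class] by (simp add: Gamma_const_def)
  have zero_\<Gamma>: "\<zero>\<^bsub>?\<Gamma>\<^esub> = Gamma_const L 0"
    using ring_hom_zero[OF hom_class P.ring_axioms \<Gamma>.ring_axioms] by (simp add: Gamma_const_def dp_const_def)
  \<comment> \<open>Bracket formulas at m = 1 involve \<gamma>_0, whereas the values of \<theta> are
    given from degree 1 on.\<close>
  have dpow_0: "dpow L 0 l = \<one>\<^bsub>?\<Gamma>\<^esub>" if "l \<in> L" for l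
  proof -
    have rel: "dp_var l 0 - dp_const 1 \<in> dp_relations L"
      using that by (auto simp: dp_relations_def)
    then have "dp_var l 0 - dp_const 1 \<in> dp_ideal L"
      unfolding dp_ideal_def using P.genideal_self[OF relations] by blast
    then have "Gamma_class L (dp_var l 0 - dp_const 1) = \<zero>\<^bsub>?\<Gamma>\<^esub>"
      by (simp add: Gamma_class_def Gamma_def FactRing_def I.a_rcos_const)
    then show ?thesis
      using class_add[of "dp_var l 0 - dp_const 1" "dp_const 1"] rel relations const_carrier[of 1]
      by (auto simp: dpow_def one_\<Gamma> Gamma_const_def dp_const_carrier)
  qed
  have hom: "\<theta> \<in> ring_hom ?\<Gamma> ?G" and \<theta>_const: "\<theta> (Gamma_const L a) = symb \<phi> 0 (\<lambda>x. a * x)" for a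
    using \<theta> by (simp_all add: graded_algebra_map_def gr_const_def)
  have \<theta>_zero: "\<theta> \<zero>\<^bsub>?\<Gamma>\<^esub> = \<zero>\<^bsub>?G\<^esub>"
    by (simp add: zero_\<Gamma> \<theta>_const gr_zero symb_eq_gr_family)
  have \<theta>_carrier: "\<theta> x \<in> carrier ?G" if "x \<in> carrier ?\<Gamma>" for x
    using ring_hom_closed[OF hom that] .
  have B_deriv: "k_derivation_on ?\<Gamma> (\<lambda>c. Gamma_const L (\<phi> c)) (\<lambda>x. B x y)" if "y \<in> carrier ?\<Gamma>" for y
    using B that unfolding is_Gamma_bracket_def poisson_structure_def by blast
  have B_carrier: "B x y \<in> carrier ?\<Gamma>" if "x \<in> carrier ?\<Gamma>" "y \<in> carrier ?\<Gamma>" for x y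
    using B_deriv[OF that(2)] that(1) by (auto simp: k_derivation_on_def)
  have B_skew: "B x y = \<ominus>\<^bsub>?\<Gamma>\<^esub> B y x" if "x \<in> carrier ?\<Gamma>" "y \<in> carrier ?\<Gamma>" for x y
    using B that unfolding is_Gamma_bracket_def poisson_structure_def by blast
  have B_const: "B (Gamma_const L a) (Gamma_const L b) = \<zero>\<^bsub>?\<Gamma>\<^esub>" for a b
    using B unfolding is_Gamma_bracket_def by blast
  have B_dpow_const: "B (dpow L m l) (Gamma_const L a) = Gamma_const L (l a) \<otimes>\<^bsub>?\<Gamma>\<^esub> dpow L (m - 1) l"
    if "l \<in> L" "1 \<le> m" for l m a
    using B that unfolding is_Gamma_bracket_def by blast
  have B_dpow: "B (dpow L m l) (dpow L n l') =
      dpow L (m - 1) l \<otimes>\<^bsub>?\<Gamma>\<^esub> dpow L (n - 1) l' \<otimes>\<^bsub>?\<Gamma>\<^esub> dpow L 1 (commutator l l')"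
    if "l \<in> L" "l' \<in> L" "1 \<le> m" "1 \<le> n" for l l' m n
    using B that unfolding is_Gamma_bracket_def by blast

  \<comment> \<open>Pairs on which the two brackets agree\<close>
  define compat where "compat x y \<longleftrightarrow> \<theta> (B x y) = gr_bracket \<phi> (\<theta> x) (\<theta> y)" for x y
  have compat_skew: "compat y x" if "compat x y" "x \<in> carrier ?\<Gamma>" "y \<in> carrier ?\<Gamma>" for x y
  proof -
    have "B y x \<oplus>\<^bsub>?\<Gamma>\<^esub> B x y = \<zero>\<^bsub>?\<Gamma>\<^esub>"
      using that B_skew[of y x] B_carrier by (simp add: \<Gamma>.l_neg)
    then have "\<theta> (B y x) \<oplus>\<^bsub>?G\<^esub> \<theta> (B x y) = \<zero>\<^bsub>?G\<^esub>"
      using ring_hom_add[OF hom B_carrier[OF that(3,2)] B_carrier[OF that(2,3)]] \<theta>_zero by simp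
    then show ?thesis
      using that gr_bracket_skew[of "\<theta> x" \<phi> "\<theta> y" "\<theta> (B y x)"]
      by (simp add: compat_def \<theta>_carrier B_carrier)
  qed
  have compat_add: "compat (x \<oplus>\<^bsub>?\<Gamma>\<^esub> x') y"
    if "compat x y" "compat x' y" "x \<in> carrier ?\<Gamma>" "x' \<in> carrier ?\<Gamma>" "y \<in> carrier ?\<Gamma>" for x x' y
  proof -
    have "B (x \<oplus>\<^bsub>?\<Gamma>\<^esub> x') y = B x y \<oplus>\<^bsub>?\<Gamma>\<^esub> B x' y"
      using B_deriv[OF that(5)] that by (simp add: k_derivation_on_def)
    then show ?thesis
      using that by (simp add: compat_def ring_hom_add[OF hom] B_carrier \<theta>_carrier gr_bracket_add)
  qed
  have compat_mult: "compat (x \<otimes>\<^bsub>?\<Gamma>\<^esub> x') y"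
    if "compat x y" "compat x' y" "x \<in> carrier ?\<Gamma>" "x' \<in> carrier ?\<Gamma>" "y \<in> carrier ?\<Gamma>" for x x' y
  proof -
    have "B (x \<otimes>\<^bsub>?\<Gamma>\<^esub> x') y = (B x y \<otimes>\<^bsub>?\<Gamma>\<^esub> x') \<oplus>\<^bsub>?\<Gamma>\<^esub> (x \<otimes>\<^bsub>?\<Gamma>\<^esub> B x' y)"
      using B_deriv[OF that(5)] that by (simp add: k_derivation_on_def)
    then show ?thesis
      using that by (simp add: compat_def ring_hom_add[OF hom] ring_hom_mult[OF hom] B_carrier
          \<theta>_carrier gr_bracket_Leibniz)
  qed

  \<comment> \<open>Degree 0 is added: \<gamma>_0 is the unit, and D_0 is the identity.\<close>
  have \<theta>_dpow: "\<exists>D\<in>HS \<phi> (enat n). D 1 = \<delta> \<and> (\<forall>i\<le>n. \<theta> (dpow L i \<delta>) = symb \<phi> i (D i))"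
    if \<delta>: "\<delta> \<in> L" "1 \<le> n" for \<delta> n
  proof -
    obtain D where D: "D \<in> HS \<phi> (enat n)" "D 1 = \<delta>" "\<forall>i\<in>{1..n}. \<theta> (dpow L i \<delta>) = symb \<phi> i (D i)"
      using integral[OF \<delta>] by blast
    have "\<theta> (dpow L 0 \<delta>) = symb \<phi> 0 (D 0)"
      using \<theta>_const[of 1] by (simp add: dpow_0 \<delta> one_\<Gamma> HS_0[OF D(1)] id_def)
    then have "\<theta> (dpow L i \<delta>) = symb \<phi> i (D i)" if "i \<le> n" for i
      using D(3) that by (cases i) auto
    with D show ?thesis by blast
  qed

  text \<open>The bracket on \<open>\<Gamma>\<^sub>A L\<close> takes values in the carrier, which forces \<open>[l, l'] \<in> L\<close>.\<close>

  have commutator_closed: "commutator l l' \<in> L" if l: "l \<in> L" "l' \<in> L" for l l'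
  proof -
    let ?v = "dp_var (commutator l l') 1"
    have "dpow L 1 (commutator l l') = dp_ideal L +>\<^bsub>?P\<^esub> ?v"
      by (simp add: dpow_def Gamma_class_def)
    then have v: "?v \<in> dpow L 1 (commutator l l')"
      using I.zero_closed by (force simp: a_r_coset_def r_coset_def)
    have "dp_const 1 \<in> \<one>\<^bsub>?\<Gamma>\<^esub>"
      using I.a_rcos_self[OF dp_const_carrier[of 1]] by (simp add: one_\<Gamma> Gamma_const_def Gamma_class_def)
    moreover have "?v \<in> dp_ideal L +>\<^bsub>?P\<^esub> (dp_const 1 * ?v)"
      using v by (simp add: dpow_def Gamma_class_def dp_const_1_mult)
    \<comment> \<open>A product of cosets contains the products of its representatives, so this
      holds before \<open>?v\<close> is known to lie in the carrier. The product is a value of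
      \<open>B\<close>, hence the coset of a carrier polynomial.\<close>
    ultimately have "?v \<in> \<one>\<^bsub>?\<Gamma>\<^esub> \<otimes>\<^bsub>?\<Gamma>\<^esub> dpow L 1 (commutator l l')"
      using v by (auto simp: Gamma_def FactRing_def rcoset_mult_def)
    also have "\<one>\<^bsub>?\<Gamma>\<^esub> \<otimes>\<^bsub>?\<Gamma>\<^esub> dpow L 1 (commutator l l') = B (dpow L 1 l) (dpow L 1 l')"
      using B_dpow[OF l, of 1 1] by (simp add: dpow_0 l)
    finally have "?v \<in> B (dpow L 1 l) (dpow L 1 l')" .
    moreover obtain p where "p \<in> carrier ?P" "B (dpow L 1 l) (dpow L 1 l') = dp_ideal L +>\<^bsub>?P\<^esub> p"
      using class_surj[OF B_carrier[OF dpow_carrier[OF l(1)] dpow_carrier[OF l(2)]], of 1 1] l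
      by (auto simp: Gamma_class_def)
    ultimately have "?v \<in> carrier ?P"
      by (auto simp: a_r_coset_def r_coset_def intro!: dp_poly_add_carrier[OF I.a_Hcarr])
    then show ?thesis
    proof (cases "(1 :: 'a) = 0")
      \<comment> \<open>Over the zero ring the variable is the zero polynomial and tells nothing,
        but all maps coincide there.\<close>
      case True
      then have "x = 0" for x :: 'a
        by (metis mult_1 mult_zero_left)
      then have "commutator l l' = l"
        by (metis ext)
      with l show ?thesis by simp
    qed (auto simp: carrier_dp_poly_ring_iff dp_var_def)
  qed

  \<comment> \<open>Agreement on constants and divided powers\<close>
  have const_diffop: "(\<lambda>x. a * x) \<in> diffop \<phi> 0" for a
    by (simp add: diffop_def diffop_lt_mult)
  have const_const: "compat (Gamma_const L a) (Gamma_const L b)" for a b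
    unfolding compat_def B_const \<theta>_zero \<theta>_const symb_bracket[OF const_diffop const_diffop]
    by (simp add: commutator_def mult.left_commute gr_zero symb_eq_gr_family)
  have dpow_const: "compat (dpow L m l) (Gamma_const L a)" if l: "l \<in> L" and m: "1 \<le> m" for l m a
  proof -
    obtain D where D: "D \<in> HS \<phi> (enat m)" "D 1 = l" "\<And>i. i \<le> m \<Longrightarrow> \<theta> (dpow L i l) = symb \<phi> i (D i)"
      using \<theta>_dpow[OF l m] by blast
    have diffop: "D i \<in> diffop \<phi> i" if "i \<le> m" for i
      using HS_diffop[OF D(1) that] by (simp add: diffop_def)
    have "\<theta> (B (dpow L m l) (Gamma_const L a)) = \<theta> (Gamma_const L (l a)) \<otimes>\<^bsub>?G\<^esub> \<theta> (dpow L (m - 1) l)"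
      unfolding B_dpow_const[OF l m] by (rule ring_hom_mult[OF hom const_carrier dpow_carrier[OF l]])
    also have "\<dots> = symb \<phi> (m - 1) (\<lambda>x. l a * D (m - 1) x)"
      using symb_mult[OF const_diffop diffop[of "m - 1"]] by (simp add: \<theta>_const D(3))
    also have "\<dots> = symb \<phi> (m - 1) (commutator (D m) (\<lambda>x. a * x))"
      using HS_commutator_mult_cong[OF D(1) order_refl, of a] m D(2)
      by (intro symb_cong[symmetric]) (cases m; simp)
    also have "\<dots> = gr_bracket \<phi> (\<theta> (dpow L m l)) (\<theta> (Gamma_const L a))"
      using symb_bracket[OF diffop[of m] const_diffop] by (simp add: \<theta>_const D(3))
    finally show ?thesis by (simp add: compat_def)
  qed
  have dpow_dpow: "compat (dpow L m l) (dpow L n l')"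
    if l: "l \<in> L" "l' \<in> L" and mn: "1 \<le> m" "1 \<le> n" for l l' m n
  proof -
    obtain D where D: "D \<in> HS \<phi> (enat m)" "D 1 = l" "\<And>i. i \<le> m \<Longrightarrow> \<theta> (dpow L i l) = symb \<phi> i (D i)"
      using \<theta>_dpow[OF l(1) mn(1)] by blast
    obtain E where E: "E \<in> HS \<phi> (enat n)" "E 1 = l'" "\<And>i. i \<le> n \<Longrightarrow> \<theta> (dpow L i l') = symb \<phi> i (E i)"
      using \<theta>_dpow[OF l(2) mn(2)] by blast
    \<comment> \<open>The commutator lies in \<open>L\<close> and has an integral \<open>K\<close>
      of length 1; it identifies \<theta> of \<gamma>_1([l, l']) with the symbol of [l, l'].\<close>
    obtain K where K: "K \<in> HS \<phi> (enat 1)" "K 1 = commutator l l'"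
      "\<theta> (dpow L 1 (commutator l l')) = symb \<phi> 1 (K 1)"
      using \<theta>_dpow[OF commutator_closed[OF l], of 1] by blast
    have diffop: "D i \<in> diffop \<phi> i" if "i \<le> m" for i
      using HS_diffop[OF D(1) that] by (simp add: diffop_def)
    have diffop': "E i \<in> diffop \<phi> i" if "i \<le> n" for i
      using HS_diffop[OF E(1) that] by (simp add: diffop_def)
    have diffop'': "commutator l l' \<in> diffop \<phi> 1"
      unfolding diffop_def K(2)[symmetric] using HS_diffop[OF K(1), of 1] by simp
    have DE: "(\<lambda>x. D (m - 1) (E (n - 1) x)) \<in> diffop \<phi> (m - 1 + (n - 1))"
      unfolding diffop_def
      by (rule diffop_lt_compose'[OF diffop[unfolded diffop_def] diffop'[unfolded diffop_def]]) auto
    have "\<theta> (B (dpow L m l) (dpow L n l')) =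
        \<theta> (dpow L (m - 1) l) \<otimes>\<^bsub>?G\<^esub> \<theta> (dpow L (n - 1) l') \<otimes>\<^bsub>?G\<^esub> \<theta> (dpow L 1 (commutator l l'))"
      unfolding B_dpow[OF l mn] by (simp add: ring_hom_mult[OF hom] l dpow_carrier commutator_closed)
    also have "\<dots> = symb \<phi> (m - 1 + (n - 1)) (\<lambda>x. D (m - 1) (E (n - 1) x)) \<otimes>\<^bsub>?G\<^esub> symb \<phi> 1 (commutator l l')"
      using symb_mult[OF diffop[of "m - 1"] diffop'[of "n - 1"]] K(3)[unfolded K(2)] by (simp add: D(3) E(3))
    also have "\<dots> = symb \<phi> (m - 1 + (n - 1) + 1) (\<lambda>x. D (m - 1) (E (n - 1) (commutator l l' x)))"
      by (rule symb_mult[OF DE diffop''])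
    also have "m - 1 + (n - 1) + 1 = m + n - 1"
      using mn by simp
    also have "symb \<phi> (m + n - 1) (\<lambda>x. D (m - 1) (E (n - 1) (commutator l l' x))) =
        symb \<phi> (m + n - 1) (commutator (D m) (E n))"
    proof (rule symb_cong[symmetric])
      have "HS_pred D m = D (m - 1)" "HS_pred E n = E (n - 1)"
        using mn by (cases m; cases n; simp)+
      then show "(\<lambda>x. commutator (D m) (E n) x - D (m - 1) (E (n - 1) (commutator l l' x)))
          \<in> diffop_lt \<phi> (m + n - 1)"
        using HS_commutator_cong[OF D(1) order_refl E(1) order_refl mn] by (simp only: D(2) E(2))
    qed
    also have "\<dots> = gr_bracket \<phi> (\<theta> (dpow L m l)) (\<theta> (dpow L n l'))"
      using symb_bracket[OF diffop[of m] diffop'[of n]] by (simp add: D(3) E(3))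
    finally show ?thesis by (simp add: compat_def)
  qed

  \<comment> \<open>Extension from generators to the whole algebra\<close>
  have compat_extend: "compat x y"
    if const: "\<And>a. compat (Gamma_const L a) y"
      and dpow: "\<And>l m. \<lbrakk>l \<in> L; 1 \<le> m\<rbrakk> \<Longrightarrow> compat (dpow L m l) y"
      and x: "x \<in> carrier ?\<Gamma>" and y: "y \<in> carrier ?\<Gamma>" for x y
  proof -
    have dpow': "compat (dpow L m l) y" if "l \<in> L" for m l
      using dpow[OF that, of m] const[of 1] dpow_0[OF that] one_\<Gamma> by (cases m) auto
    obtain p where "p \<in> carrier ?P" "x = Gamma_class L p"
      using class_surj[OF x] by blast
    moreover from \<open>p \<in> carrier ?P\<close> have "compat (Gamma_class L p) y"
    proof (induction p rule: dp_poly_induct)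
      case (const a)
      then show ?case using that(1) by (simp add: Gamma_const_def)
    next
      case (var l n)
      then show ?case using dpow' by (simp add: dpow_def)
    next
      case (add p q)
      then show ?case by (simp add: class_add compat_add class_carrier y)
    next
      case (mult p q)
      then show ?case by (simp add: class_mult compat_mult class_carrier y)
    qed
    ultimately show ?thesis by simp
  qed
  \<comment> \<open>Extension works in the first argument only: all elements are paired with
    generators first, then skew-symmetry exchanges the arguments for a second extension.\<close>
  have const_all: "compat y (Gamma_const L a)" if "y \<in> carrier ?\<Gamma>" for a y
    by (rule compat_extend[OF const_const dpow_const that const_carrier])
  have dpow_all: "compat y (dpow L m l)" if l: "l \<in> L" and m: "1 \<le> m" and y: "y \<in> carrier ?\<Gamma>" for m l y
  proof (rule compat_extend[OF _ dpow_dpow[OF _ l _ m] y dpow_carrier[OF l]])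
    show "compat (Gamma_const L a) (dpow L m l)" for a
      by (rule compat_skew[OF dpow_const[OF l m] dpow_carrier[OF l] const_carrier])
  qed
  have "compat x y" if x: "x \<in> carrier ?\<Gamma>" and y: "y \<in> carrier ?\<Gamma>" for x y
    using compat_extend[OF compat_skew[OF const_all[OF y] y const_carrier]
        compat_skew[OF dpow_all[OF _ _ y] y dpow_carrier] x y] by blast
  then show ?thesis
    using hom \<theta>_const by (simp add: poisson_map_def compat_def gr_const_def)
qed

theorem proposition4p2:
  fixes \<phi> :: "'k::{comm_ring,comm_monoid_mult} \<Rightarrow> 'a::{comm_ring,comm_monoid_mult}"
  assumes "algebra_map \<phi>"
  shows
    "(\<forall>B \<theta>. is_Gamma_bracket \<phi> (IDer_f \<phi>) B \<and> is_vartheta_f \<phi> \<theta> \<longrightarrow>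
        poisson_map
          (Gamma (IDer_f \<phi>)) (\<lambda>c. Gamma_const (IDer_f \<phi>) (\<phi> c)) B
          (gr_ring \<phi>) (\<lambda>c. gr_const \<phi> (\<phi> c)) (gr_bracket \<phi>) \<theta>) \<and>
     (\<forall>B \<theta>. is_Gamma_bracket \<phi> (IDer \<phi> \<infinity>) B \<and> is_vartheta_inf \<phi> \<theta> \<longrightarrow>
        poisson_map
          (Gamma (IDer \<phi> \<infinity>)) (\<lambda>c. Gamma_const (IDer \<phi> \<infinity>) (\<phi> c)) B
          (gr_ring \<phi>) (\<lambda>c. gr_const \<phi> (\<phi> c)) (gr_bracket \<phi>) \<theta>)"
proof (intro conjI allI impI; elim conjE)
  fix B \<theta>
  assume B: "is_Gamma_bracket \<phi> (IDer_f \<phi>) B" and \<theta>: "is_vartheta_f \<phi> \<theta>"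
  show "poisson_map (Gamma (IDer_f \<phi>)) (\<lambda>c. Gamma_const (IDer_f \<phi>) (\<phi> c)) B
      (gr_ring \<phi>) (\<lambda>c. gr_const \<phi> (\<phi> c)) (gr_bracket \<phi>) \<theta>"
  proof (rule poisson_map_of_integrals[OF B])
    show "graded_algebra_map \<phi> (IDer_f \<phi>) \<theta>"
      using \<theta> by (simp add: is_vartheta_f_def)
    fix \<delta> and n :: nat
    assume \<delta>: "\<delta> \<in> IDer_f \<phi>" and "1 \<le> n"
    then have "\<delta> \<in> IDer \<phi> (enat n)" by (auto simp: IDer_f_def)
    then obtain D where D: "D \<in> HS \<phi> (enat n)" "D 1 = \<delta>" by (auto simp: IDer_def)
    \<comment> \<open>The integral depends on \<open>n\<close>, but its truncation at i \<le> n is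
      an i-integral of \<delta>, so the single \<open>D\<close> gives the value in every degree up
      to \<open>n\<close>.\<close>
    have "\<theta> (dpow (IDer_f \<phi>) i \<delta>) = symb \<phi> i (D i)" if "i \<in> {1..n}" for i
    proof -
      have "D \<in> HS \<phi> (enat i)" using that by (intro HS_mono[OF D(1)]) simp
      then show ?thesis using \<theta> \<delta> D(2) that by (simp add: is_vartheta_f_def)
    qed
    with D show "\<exists>D\<in>HS \<phi> (enat n). D 1 = \<delta> \<and>
        (\<forall>i\<in>{1..n}. \<theta> (dpow (IDer_f \<phi>) i \<delta>) = symb \<phi> i (D i))" by blast
  qed
next
  fix B \<theta>
  assume B: "is_Gamma_bracket \<phi> (IDer \<phi> \<infinity>) B" and \<theta>: "is_vartheta_inf \<phi> \<theta>"
  show "poisson_map (Gamma (IDer \<phi> \<infinity>)) (\<lambda>c. Gamma_const (IDer \<phi> \<infinity>) (\<phi> c)) B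
      (gr_ring \<phi>) (\<lambda>c. gr_const \<phi> (\<phi> c)) (gr_bracket \<phi>) \<theta>"
  proof (rule poisson_map_of_integrals[OF B])
    show "graded_algebra_map \<phi> (IDer \<phi> \<infinity>) \<theta>"
      using \<theta> by (simp add: is_vartheta_inf_def)
    fix \<delta> and n :: nat
    assume \<delta>: "\<delta> \<in> IDer \<phi> \<infinity>" and "1 \<le> n"
    then obtain D where D: "D \<in> HS \<phi> \<infinity>" "D 1 = \<delta>" by (auto simp: IDer_def)
    have "\<theta> (dpow (IDer \<phi> \<infinity>) i \<delta>) = symb \<phi> i (D i)" if "i \<in> {1..n}" for i
      using \<theta> \<delta> D that by (simp add: is_vartheta_inf_def)
    \<comment> \<open>Here one integral of infinite length serves all degrees and is only
      truncated.\<close>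
    moreover have "D \<in> HS \<phi> (enat n)" by (rule HS_mono[OF D(1)]) simp
    ultimately show "\<exists>D\<in>HS \<phi> (enat n). D 1 = \<delta> \<and>
        (\<forall>i\<in>{1..n}. \<theta> (dpow (IDer \<phi> \<infinity>) i \<delta>) = symb \<phi> i (D i))" using D(2) by blast
  qed
qed

end
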